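(* Let $G$ be a graph on $n$ vertices and let $\mathcal{T}_1=(B_1,l_1)$ and $\mathcal{T}_2=(B_2,l_2)$ be two labelled spanning trees of $G$ such that for each label $i$, the edge $l_1^{-1}(i)$ and the edge $l_2^{-1}(i)$ lie in the same 2-connected component (block) of $G$. Then $\mathcal{T}_1$ can be reconfigured to $\mathcal{T}_2$ using $O(n\log n)$ basis exchange steps.
   Context: A labelled spanning tree of an $n$-vertex graph $G$ is a pair $(B,l)$ where $B$ is the edge set of a spanning tree and $l:B\to\{1,\ldots,n-1\}$ is a bijection. A basis exchange step on $(B,l)$ removes an edge $e\in B$ and adds an edge $e'\notin B$ such that $(B\setminus\{e\})\cup\{e'\}$ is a spanning tree; $e'$ receives the label $l(e)$ and all other labels are unchanged. Two edges lie in the same block of $G$ iff they are equal or some cycle of $G$ contains both. *)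

theory Defs
  imports Complex_Main "HOL-Library.FuncSet" "HOL-Library.Landau_Symbols"
begin

definition simple_graph :: "'a set \<Rightarrow> 'a set set \<Rightarrow> bool" where
  "simple_graph V E \<longleftrightarrow> finite V \<and> (\<forall>e\<in>E. e \<subseteq> V \<and> card e = 2)"

definition graph_connected :: "'a set \<Rightarrow> 'a set set \<Rightarrow> bool" where
  "graph_connected V E \<longleftrightarrow> (\<forall>u\<in>V. \<forall>v\<in>V. (u, v) \<in> {(x, y). {x, y} \<in> E}\<^sup>*)"

text \<open>A cycle is given by the list of its distinct vertices in cyclic order.\<close>

definition cycle_edges :: "'a list \<Rightarrow> 'a set set" where
  "cycle_edges vs = {{vs ! i, vs ! (Suc i mod length vs)} | i. i < length vs}"

definition is_cycle :: "'a set set \<Rightarrow> 'a list \<Rightarrow> bool" where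
  "is_cycle E vs \<longleftrightarrow> 3 \<le> length vs \<and> distinct vs \<and> cycle_edges vs \<subseteq> E"

definition spanning_tree :: "'a set \<Rightarrow> 'a set set \<Rightarrow> 'a set set \<Rightarrow> bool" where
  "spanning_tree V E B \<longleftrightarrow> B \<subseteq> E \<and> graph_connected V B \<and> (\<nexists>vs. is_cycle B vs)"

definition same_block :: "'a set set \<Rightarrow> 'a set \<Rightarrow> 'a set \<Rightarrow> bool" where
  "same_block E e f \<longleftrightarrow>
     e = f \<or> (\<exists>vs. is_cycle E vs \<and> e \<in> cycle_edges vs \<and> f \<in> cycle_edges vs)"

text \<open>Labellings are extensional (\<^const>\<open>undefined\<close> outside the tree), so that equality of pairs
  is equality of labelled trees.\<close>

type_synonym 'a labelled_tree = "'a set set \<times> ('a set \<Rightarrow> nat)"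

definition labelled_spanning_tree :: "'a set \<Rightarrow> 'a set set \<Rightarrow> 'a labelled_tree \<Rightarrow> bool" where
  "labelled_spanning_tree V E = (\<lambda>(B, l).
     spanning_tree V E B \<and> l \<in> extensional B \<and> bij_betw l B {1..card V - 1})"

definition exchange_step ::
    "'a set \<Rightarrow> 'a set set \<Rightarrow> 'a labelled_tree \<Rightarrow> 'a labelled_tree \<Rightarrow> bool" where
  "exchange_step V E = (\<lambda>(B, l) (B', l').
     \<exists>e\<in>B. \<exists>e'\<in>E - B.
       B' = (B - {e}) \<union> {e'} \<and> spanning_tree V E B' \<and> l' = restrict (l(e' := l e)) B')"

end

theory Submission
  imports Defs "HOL-Real_Asymp.Real_Asymp"
begin


text \<open>
  Call two edges of a spanning tree \<open>B\<close> adjacent if some edge \<open>x\<close> outside \<open>B\<close> closes a cycle through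
  both of them; then three exchanges, using \<open>x\<close> as a buffer, swap their labels. By conjugation, the labels
  of two edges at distance \<open>k\<close> can be swapped in \<open>O(k)\<close> exchanges. It therefore suffices to find one
  spanning tree in which any two edges of the same block have distance \<open>O(log n)\<close>: both labelled trees
  are first moved to it in at most \<open>n\<close> exchanges each, and the labels are then sorted by at most \<open>n\<close>
  transpositions.

  Splitting at cut vertices reduces the construction of that tree to graphs without a cut vertex.
  There we start from one edge and add ears. Through a component \<open>K\<close> of the
  vertices not yet covered there is an ear that leaves only components with at most \<open>|K| / 2\<close> vertices: if
  an ear leaves a larger component \<open>K'\<close>, reroute it through \<open>K'\<close> between two consecutive attachments of
  \<open>K'\<close>, which strictly shrinks the large component. Dropping one edge of the ear makes all its other edges
  adjacent to an edge of the old tree, so each halving costs one unit of distance.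
\<close>

section \<open>Connectivity, paths and edge counts\<close>

text \<open>The obstacle is to keep every label inside its block without treating blocks as objects.
  The proof carries instead the equivalence generated by single exchanges,
  \<open>(exchangeable V E)\<^sup>*\<close>: two edges of a common cycle are related, every exchange
  step moves a label to a related edge, and no exchange crosses a cut vertex, as all bases have
  equally many edges on each side. So any route to the common tree leaves the two bearers of a label
  related, and sorting swaps only related edges.

  A halving may cost only one unit of distance, so a new ear has to be tied to edges of small
  distance. Hence for each uncovered component a set of shallow tree edges linking all its
  attachments is remembered; the ends of the ear are joined inside that set, and one edge of this
  connection shares a circuit with all kept ear edges.

  Constants: the distance to the root is at most \<open>1 + log 2 n\<close>, so twice that between
  two edges; each unit costs two swaps of three exchanges; at most n swaps give
  \<open>12 * n * (1 + log 2 n)\<close>, and the two moves to the common tree add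
  \<open>2 * n\<close>.\<close>

abbreviation reach :: "'a set set \<Rightarrow> ('a \<times> 'a) set" where
  "reach A \<equiv> {(x, y). {x, y} \<in> A}\<^sup>*"

lemma reach_mono: "A \<subseteq> A' \<Longrightarrow> reach A \<subseteq> reach A'"
  by (rule rtrancl_mono) auto

lemma reach_mono': "(x, y) \<in> reach A \<Longrightarrow> A \<subseteq> A' \<Longrightarrow> (x, y) \<in> reach A'"
  using reach_mono by blast

lemma reach_trans: "(x, y) \<in> reach A \<Longrightarrow> (y, z) \<in> reach A \<Longrightarrow> (x, z) \<in> reach A"
  by (rule rtrancl_trans)

lemma reach_sym: "(x, y) \<in> reach A \<Longrightarrow> (y, x) \<in> reach A"
proof -
  have "sym {(x, y). {x, y} \<in> A}" by (auto simp: sym_def insert_commute)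
  then show "(x, y) \<in> reach A \<Longrightarrow> (y, x) \<in> reach A"
    by (metis sym_rtrancl symE)
qed

lemma reach_edge: "{x, y} \<in> A \<Longrightarrow> (x, y) \<in> reach A"
  by auto

lemma reach_subst:
  assumes "(x, y) \<in> reach A" "\<And>a b. {a, b} \<in> A \<Longrightarrow> (a, b) \<in> reach A'"
  shows "(x, y) \<in> reach A'"
  using assms(1)
proof (induction rule: rtrancl_induct)
  case (step y z)
  then show ?case using assms(2)[of y z] by (auto intro: rtrancl_trans)
qed simp

lemma graph_connectedI:
  assumes "\<And>v. v \<in> V \<Longrightarrow> (c, v) \<in> reach A"
  shows "graph_connected V A"
  unfolding graph_connected_def using assms by (blast intro: reach_sym rtrancl_trans)

lemma graph_connectedD: "graph_connected V A \<Longrightarrow> u \<in> V \<Longrightarrow> v \<in> V \<Longrightarrow> (u, v) \<in> reach A"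
  unfolding graph_connected_def by blast

lemma graph_connected_mono: "graph_connected V A \<Longrightarrow> A \<subseteq> A' \<Longrightarrow> graph_connected V A'"
  unfolding graph_connected_def using reach_mono by blast

lemma reach_insert:
  assumes "(x, y) \<in> reach (insert {a, b} A)" "(x, y) \<notin> reach A"
  shows "(x, a) \<in> reach A \<and> (b, y) \<in> reach A \<or> (x, b) \<in> reach A \<and> (a, y) \<in> reach A"
  using assms
proof (induction rule: rtrancl_induct)
  case (step y z)
  show ?case
  proof (cases "{y, z} \<in> A")
    case True
    then have yz: "(y, z) \<in> reach A" by (rule reach_edge)
    then show ?thesis using step by (meson rtrancl_trans)
  next
    case False
    then have "y = a \<and> z = b \<or> y = b \<and> z = a"
      using step(2) by (auto simp: doubleton_eq_iff)
    then show ?thesis using step by (metis rtrancl.rtrancl_refl)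
  qed
qed simp

text \<open>Each edge lowers the number of pairwise unreachable vertices by at most one.\<close>

lemma unreachable_set:
  assumes "finite A" "finite V" "\<And>e. e \<in> A \<Longrightarrow> card e = 2"
  shows "\<exists>R\<subseteq>V. card V \<le> card R + card A \<and> (\<forall>x\<in>R. \<forall>y\<in>R. (x, y) \<in> reach A \<longrightarrow> x = y)"
  using assms(1,3)
proof (induction A rule: finite_induct)
  case empty
  then show ?case by auto
next
  case (insert e A)
  then obtain R where R: "R \<subseteq> V" "card V \<le> card R + card A"
    and ind: "\<And>x y. x \<in> R \<Longrightarrow> y \<in> R \<Longrightarrow> (x, y) \<in> reach A \<Longrightarrow> x = y" by auto
  obtain a b where e: "e = {a, b}" using insert by (metis card_2_iff insertI1)
  have finR: "finite R" using R assms(2) finite_subset by blast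
  \<comment> \<open>At most one vertex of \<open>R\<close> reaches \<open>a\<close>. Once it is
    removed, no two of the others can be joined through the new edge, since one of them would reach
    \<open>a\<close>.\<close>
  define R' where "R' = R - {x \<in> R. (x, a) \<in> reach A}"
  have "{x \<in> R. (x, a) \<in> reach A} \<subseteq> {x} " if "x \<in> R" "(x, a) \<in> reach A" for x
    using that ind by (blast intro: reach_sym rtrancl_trans)
  then have "card {x \<in> R. (x, a) \<in> reach A} \<le> 1"
    by (metis (no_types, lifting) card.empty card_mono empty_Collect_eq finite.emptyI finite.insertI is_singletonI
        is_singleton_altdef less_one linorder_le_less_linear order_less_imp_le)
  then have "card R \<le> card R' + 1"
    unfolding R'_def using finR by (simp add: card_Diff_subset)
  moreover have "x = y" if xy: "x \<in> R'" "y \<in> R'" "(x, y) \<in> reach (insert e A)" for x y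
  proof (rule ccontr)
    assume "x \<noteq> y"
    then have "(x, y) \<notin> reach A" using ind xy unfolding R'_def by blast
    then show False
      using reach_insert[of x y a b A] xy unfolding e R'_def by (auto dest: reach_sym)
  qed
  ultimately show ?case using R insert(1,2) by (intro exI[of _ R']) (auto simp: R'_def)
qed

lemma card_connected_ge:
  assumes "finite A" "finite V" "\<And>e. e \<in> A \<Longrightarrow> card e = 2" "graph_connected V A"
  shows "card V - 1 \<le> card A"
proof -
  obtain R where R: "R \<subseteq> V" "card V \<le> card R + card A"
      and "\<forall>x\<in>R. \<forall>y\<in>R. (x, y) \<in> reach A \<longrightarrow> x = y"
    using unreachable_set[OF assms(1-3)] by blast
  then have "\<forall>x\<in>R. \<forall>y\<in>R. x = y"
    using assms(4) unfolding graph_connected_def by (meson subsetD)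
  moreover have "finite R" using R assms(2) finite_subset by blast
  ultimately have "card R \<le> 1" by (simp add: card_le_Suc0_iff_eq)
  then show ?thesis using R by linarith
qed

section \<open>Paths as vertex lists, and what survives the loss of one edge\<close>

fun path_edges :: "'a list \<Rightarrow> 'a set set" where
  "path_edges (x # y # zs) = insert {x, y} (path_edges (y # zs))"
| "path_edges _ = {}"

lemma path_edges_append:
  "path_edges (xs @ a # b # ys) = insert {a, b} (path_edges (xs @ [a]) \<union> path_edges (b # ys))"
  by (induction xs rule: path_edges.induct) auto

lemma path_edges_split: "g \<in> path_edges L \<Longrightarrow> \<exists>xs a b ys. L = xs @ a # b # ys \<and> g = {a, b}"
proof (induction L rule: path_edges.induct)
  case (1 x y zs)
  then show ?case
  proof (cases "g = {x, y}")
    case False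
    then obtain xs a b ys where "y # zs = xs @ a # b # ys \<and> g = {a, b}" using 1 by auto
    then show ?thesis by (intro exI[of _ "x # xs"]) auto
  qed (use append_Nil in blast)
qed auto

lemma path_edges_subset: "e \<in> path_edges L \<Longrightarrow> e \<subseteq> set L"
  by (induction L rule: path_edges.induct) auto

lemma reach_path_edges: "z \<in> set L \<Longrightarrow> (hd L, z) \<in> reach (path_edges L)"
proof (induction L rule: path_edges.induct)
  case (1 x y zs)
  show ?case
  proof (cases "z = x")
    case False
    then have "(y, z) \<in> reach (path_edges (y # zs))" using 1 by auto
    then have "(y, z) \<in> reach (path_edges (x # y # zs))"
      using reach_mono[of "path_edges (y # zs)" "path_edges (x # y # zs)"] by auto
    then show ?thesis by (auto intro: converse_rtrancl_into_rtrancl)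
  qed simp
qed auto

lemma finite_path_edges [simp]: "finite (path_edges L)"
  by (induction L rule: path_edges.induct) auto

lemma card_path_edges: "card (path_edges L) \<le> length L - 1"
proof (induction L rule: path_edges.induct)
  case (1 x y zs)
  then show ?case using card_insert_le_m1[of "length (x # y # zs) - 1" "path_edges (y # zs)" "{x, y}"] by simp
qed auto

lemma path_edges_subset_successively:
  "successively (\<lambda>x y. {x, y} \<in> E) L \<longleftrightarrow> path_edges L \<subseteq> E"
  by (induction L rule: path_edges.induct) auto

text \<open>Cutting at \<open>g\<close> leaves two sublists, each still attached to its end of
  \<open>L\<close>. Distinctness ensures that neither uses \<open>g\<close> again.\<close>

lemma reach_path_edges_remove:
  assumes "distinct L" "g \<in> path_edges L" "z \<in> set L"
  shows "(hd L, z) \<in> reach (path_edges L - {g}) \<or> (last L, z) \<in> reach (path_edges L - {g})"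
proof -
  obtain xs a b ys where L: "L = xs @ a # b # ys" and g: "g = {a, b}"
    using path_edges_split[OF assms(2)] by blast
  have 1: "path_edges (xs @ [a]) \<subseteq> path_edges L - {g}"
    using path_edges_subset[of g "xs @ [a]"] assms(1) by (auto simp: L g path_edges_append)
  have 2: "path_edges (b # ys) \<subseteq> path_edges L - {g}"
    using path_edges_subset[of g "b # ys"] assms(1) by (auto simp: L g path_edges_append)
  show ?thesis
  proof (cases "z \<in> set (xs @ [a])")
    case True
    have "hd (xs @ [a]) = hd L" by (simp add: L hd_append)
    then show ?thesis using reach_path_edges[OF True] reach_mono[OF 1] by auto
  next
    case False
    then have "z \<in> set (b # ys)" using assms(3) by (auto simp: L)
    moreover have "last L \<in> set (b # ys)" by (simp add: L)
    ultimately have "(hd (b # ys), z) \<in> reach (path_edges L - {g})"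
        "(hd (b # ys), last L) \<in> reach (path_edges L - {g})"
      using reach_mono'[OF reach_path_edges 2] by blast+
    then have "(last L, z) \<in> reach (path_edges L - {g})" by (rule reach_trans[OF reach_sym, rotated])
    then show ?thesis ..
  qed
qed

text \<open>Loop erasure: a vertex that already occurs on the path makes the path restart at that
  occurrence.\<close>

lemma path_list_exists:
  assumes "(x, y) \<in> r\<^sup>*"
  shows "\<exists>L. L \<noteq> [] \<and> distinct L \<and> hd L = x \<and> last L = y \<and> successively (\<lambda>a b. (a, b) \<in> r) L"
  using assms
proof (induction rule: converse_rtrancl_induct)
  case base
  then show ?case by (intro exI[of _ "[y]"]) simp
next
  case (step x z)
  then obtain L where L: "L \<noteq> []" "distinct L" "hd L = z" "last L = y"
      "successively (\<lambda>a b. (a, b) \<in> r) L" by blast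
  show ?case
  proof (cases "x \<in> set L")
    case True
    then obtain xs ys where "L = xs @ x # ys" by (meson split_list)
    then show ?thesis using L by (intro exI[of _ "x # ys"]) (auto simp: successively_append_iff)
  next
    case False
    then show ?thesis using L step(1)
      by (intro exI[of _ "x # L"]) (cases L, auto)
  qed
qed

text \<open>Basis exchange in general form: each end of \<open>g\<close> is joined along the rest of
  \<open>L\<close> to \<open>hd L\<close> or \<open>last L\<close>, and these two are joined in
  \<open>B'\<close>, so \<open>g\<close> can be bypassed.\<close>

lemma graph_connected_exchange_path:
  assumes "graph_connected V B" "distinct L" "path_edges L \<subseteq> B" "g \<in> path_edges L"
  assumes "(hd L, last L) \<in> reach B'" "B - {g} \<subseteq> B'"
  shows "graph_connected V B'"
proof -
  have ab: "(a, b) \<in> reach B'" if "{a, b} \<in> B" for a b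
  proof (cases "{a, b} = g")
    case False
    then show ?thesis using that assms(6) by (auto intro: reach_edge)
  next
    case True
    have "path_edges L - {g} \<subseteq> B'" using assms by auto
    then have *: "(hd L, z) \<in> reach B'" if "z \<in> set L" for z
      using reach_path_edges_remove[OF assms(2,4) that] assms(5)
      by (blast intro: reach_mono' reach_trans)
    have "a \<in> set L" "b \<in> set L" using path_edges_subset[OF assms(4)] True by auto
    then show ?thesis using * reach_sym reach_trans by metis
  qed
  show ?thesis
    using assms(1) unfolding graph_connected_def by (blast intro: reach_subst ab)
qed

text \<open>Spanning trees, with acyclicity replaced by an edge count.\<close>

definition tree_basis :: "'a set \<Rightarrow> 'a set set \<Rightarrow> 'a set set \<Rightarrow> bool" where
  "tree_basis V E B \<longleftrightarrow> B \<subseteq> E \<and> graph_connected V B \<and> card B = card V - 1"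

lemma simple_graph_finite: "simple_graph V E \<Longrightarrow> finite E"
  unfolding simple_graph_def by (rule finite_subset[of _ "Pow V"]) auto

lemma simple_graph_subset: "simple_graph V E \<Longrightarrow> A \<subseteq> E \<Longrightarrow> simple_graph V A"
  unfolding simple_graph_def by blast

lemma simple_graph_card_ge:
  "simple_graph V E \<Longrightarrow> graph_connected V E \<Longrightarrow> card V - 1 \<le> card E"
  by (rule card_connected_ge) (erule simple_graph_finite, auto simp: simple_graph_def)

lemma tree_basisI:
  assumes "simple_graph V E" "B \<subseteq> E" "graph_connected V B" "card B \<le> card V - 1"
  shows "tree_basis V E B"
  using assms simple_graph_card_ge[OF simple_graph_subset[OF assms(1,2)]]
  unfolding tree_basis_def by auto

text \<open>Rotating the cycle makes \<open>e\<close> the closing edge from the last to the first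
  vertex; the list read as a path then avoids it.\<close>

lemma cycle_edge_path:
  assumes "3 \<le> length vs" "distinct vs" "e \<in> cycle_edges vs"
  shows "\<exists>L. set L = set vs \<and> path_edges L \<subseteq> cycle_edges vs - {e}"
proof -
  let ?n = "length vs"
  obtain i where i: "i < ?n" "e = {vs ! i, vs ! (Suc i mod ?n)}"
    using assms(3) unfolding cycle_edges_def by blast
  define L where "L = rotate (Suc i) vs"
  have len: "length L = ?n" "L \<noteq> []" and d: "distinct L" and s: "set L = set vs"
    using assms unfolding L_def by auto
  have nthL: "L ! j = vs ! ((Suc i + j) mod ?n)" if "j < ?n" for j
    unfolding L_def using that by (simp add: nth_rotate del: rotate_Suc)
  have hd: "hd L = vs ! (Suc i mod ?n)" using nthL[of 0] assms(1) len by (cases vs) (simp_all add: hd_conv_nth)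
  have "Suc i + (?n - 1) = i + ?n" using assms(1) by simp
  then have "last L = vs ! i" using nthL[of "?n - 1"] assms len i by (simp add: last_conv_nth)
  then have e: "e = {hd L, last L}" using hd i by auto
  have "g \<in> cycle_edges vs \<and> g \<noteq> e" if gL: "g \<in> path_edges L" for g
  proof -
    obtain xs a b ys where L: "L = xs @ a # b # ys" and g: "g = {a, b}"
      using path_edges_split[OF gL] by blast
    have j: "Suc (length xs) < ?n" unfolding len(1)[symmetric] L by simp
    have "a = vs ! ((Suc i + length xs) mod ?n)" using nthL[of "length xs"] j L by (simp add: nth_append)
    moreover have "b = vs ! (Suc ((Suc i + length xs) mod ?n) mod ?n)"
      using nthL[of "Suc (length xs)"] j L by (simp add: nth_append mod_Suc_eq)
    ultimately have "g \<in> cycle_edges vs"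
      unfolding cycle_edges_def g using i by (intro CollectI exI[of _ "(Suc i + length xs) mod ?n"]) (auto intro: mod_less_divisor)
    \<comment> \<open>A path edge that joins both ends of a distinct list is the whole path, so only
      two vertices would be left.\<close>
    moreover have "g \<noteq> e"
    proof
      assume "g = e"
      then have *: "a = hd L \<and> b = last L \<or> a = last L \<and> b = hd L" unfolding g e by (auto simp: doubleton_eq_iff)
      have "last L \<in> set (b # ys)" using L by simp
      then have "a \<noteq> last L" using d L by auto
      then have ab: "a = hd L" "b = last L" using * by auto
      have "xs = []" using ab(1) d unfolding L by (cases xs) auto
      moreover have "ys = []" using ab(2) d unfolding L by (cases ys rule: rev_cases) auto
      ultimately show False using L len assms(1) by simp
    qed
    ultimately show ?thesis ..
  qed
  then show ?thesis using s by (intro exI[of _ L]) auto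
qed

lemma cycle_remove_edge_connected:
  assumes "3 \<le> length vs" "distinct vs" "e \<in> cycle_edges vs"
  shows "graph_connected (set vs) (cycle_edges vs - {e})"
proof -
  obtain L where L: "set L = set vs" "path_edges L \<subseteq> cycle_edges vs - {e}"
    using cycle_edge_path[OF assms] by blast
  show ?thesis
    using reach_path_edges[of _ L] reach_mono[OF L(2)] L(1) by (intro graph_connectedI[of _ "hd L"]) auto
qed

text \<open>An edge of a cycle could be dropped without losing connectivity, leaving fewer edges
  than a connected graph on \<open>V\<close> must have.\<close>

lemma tree_basis_spanning_tree:
  assumes sg: "simple_graph V E" and B: "tree_basis V E B"
  shows "spanning_tree V E B"
proof -
  have "\<not> is_cycle B vs" for vs
  proof
    assume "is_cycle B vs"
    then have vs: "3 \<le> length vs" "distinct vs" "cycle_edges vs \<subseteq> B" unfolding is_cycle_def by auto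
    define e where "e = {vs ! 0, vs ! (Suc 0 mod length vs)}"
    have e: "e \<in> cycle_edges vs" unfolding cycle_edges_def e_def using vs(1) by (intro CollectI exI[of _ 0]) auto
    have "e \<subseteq> set vs" using vs(1) unfolding e_def by (auto intro!: nth_mem mod_less_divisor)
    have ab: "(a, b) \<in> reach (B - {e})" if "{a, b} \<in> B" for a b
    proof (cases "{a, b} = e")
      case True
      then have "(a, b) \<in> reach (cycle_edges vs - {e})"
        using cycle_remove_edge_connected[OF vs(1,2) e] \<open>e \<subseteq> set vs\<close> by (intro graph_connectedD) auto
      then show ?thesis using reach_mono[of "cycle_edges vs - {e}" "B - {e}"] vs by blast
    qed (use that in auto)
    then have "graph_connected V (B - {e})"
      using B unfolding tree_basis_def graph_connected_def by (blast intro: reach_subst ab)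
    moreover have "simple_graph V (B - {e})"
      using sg B unfolding tree_basis_def by (blast intro: simple_graph_subset)
    ultimately have "card V - 1 \<le> card (B - {e})" by (rule simple_graph_card_ge[rotated])
    moreover have "card (B - {e}) < card B"
      using B e vs(3) simple_graph_finite[OF sg] unfolding tree_basis_def
      by (meson card_Diff1_less finite_subset subsetD)
    ultimately show False using B unfolding tree_basis_def by simp
  qed
  then show ?thesis using B unfolding spanning_tree_def tree_basis_def by auto
qed


section \<open>Blocks via basis exchange\<close>

text \<open>The transitive closure of this relation plays the role of lying in the same block.\<close>

definition exchangeable :: "'a set \<Rightarrow> 'a set set \<Rightarrow> ('a set \<times> 'a set) set" where
  "exchangeable V E = {(e, f). \<exists>X. e \<notin> X \<and> f \<notin> X \<and>
     tree_basis V E (insert e X) \<and> tree_basis V E (insert f X)}"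

lemma exchangeable_rtrancl_sym:
  "(e, f) \<in> (exchangeable V E)\<^sup>* \<Longrightarrow> (f, e) \<in> (exchangeable V E)\<^sup>*"
proof -
  have "sym (exchangeable V E)" unfolding exchangeable_def sym_def by auto
  then show "(e, f) \<in> (exchangeable V E)\<^sup>* \<Longrightarrow> (f, e) \<in> (exchangeable V E)\<^sup>*"
    by (metis sym_rtrancl symE)
qed

lemma edge_leaving:
  assumes "graph_connected V E" "x \<in> U" "x \<in> V" "y \<in> V" "y \<notin> U"
  shows "\<exists>a b. {a, b} \<in> E \<and> a \<in> U \<and> b \<notin> U"
proof (rule ccontr)
  assume no: "\<not> ?thesis"
  have "(x, y) \<in> reach E" using assms graph_connectedD by metis
  then have "y \<in> U"
    by (induction rule: rtrancl_induct) (use assms no in auto)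
  then show False using assms by simp
qed

text \<open>\<open>Q\<close> has at most one edge per vertex outside \<open>U\<close> and is chosen
  before \<open>A\<close>. The same \<open>Q\<close> therefore completes a cycle minus any of its
  edges, which makes the resulting bases comparable.\<close>

lemma connected_extension:
  assumes sg: "simple_graph V E" and con: "graph_connected V E" and U: "U \<subseteq> V" "U \<noteq> {}"
  shows "\<exists>Q\<subseteq>E. card Q \<le> card V - card U \<and> (\<forall>A. graph_connected U A \<longrightarrow> graph_connected V (A \<union> Q))"
  using U
proof (induction "card (V - U)" arbitrary: U)
  case 0
  then have "U = V" using sg unfolding simple_graph_def by auto
  then show ?case by (intro exI[of _ "{}"]) auto
next
  case (Suc n)
  have fin: "finite V" using sg unfolding simple_graph_def by simp
  obtain x y where "x \<in> U" "y \<in> V" "y \<notin> U" using Suc by (metis Diff_eq_empty_iff all_not_in_conv card.empty nat.distinct(1) subsetI)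
  then obtain a b where ab: "{a, b} \<in> E" "a \<in> U" "b \<notin> U"
    using edge_leaving[OF con, of x U y] Suc.prems by auto
  then have bV: "b \<in> V" using sg unfolding simple_graph_def by auto
  have "V - U = insert b (V - insert b U)" using ab bV by auto
  then have "card (V - U) = Suc (card (V - insert b U))"
    using fin by (metis DiffD2 card_insert_disjoint finite_Diff insertI1)
  then have "n = card (V - insert b U)" using Suc by simp
  from Suc(1)[OF this] obtain Q where Q: "Q \<subseteq> E" "card Q \<le> card V - card (insert b U)"
     and Qc: "\<And>A. graph_connected (insert b U) A \<Longrightarrow> graph_connected V (A \<union> Q)"
    using Suc.prems bV by blast
  have "finite U" using Suc.prems fin finite_subset by blast
  then have cU: "card (insert b U) = Suc (card U)" using ab by simp
  have "card (insert b U) \<le> card V" using Suc.prems bV fin by (intro card_mono) auto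
  then have "card (insert {a, b} Q) \<le> card V - card U"
    using Q(2) cU card_insert_le_m1[of "card V - card U" Q "{a, b}"] by auto
  moreover have "graph_connected V (A \<union> insert {a, b} Q)" if A: "graph_connected U A" for A
  proof -
    have "graph_connected (insert b U) (insert {a, b} A)"
    proof (rule graph_connectedI[of _ a])
      fix v assume v: "v \<in> insert b U"
      show "(a, v) \<in> reach (insert {a, b} A)"
      proof (cases "v = b")
        case False
        then have "(a, v) \<in> reach A" using graph_connectedD[OF A] ab v by auto
        then show ?thesis by (rule reach_mono') auto
      qed (auto intro: reach_edge)
    qed
    from Qc[OF this] show ?thesis by simp
  qed
  ultimately show ?case using ab Q by (intro exI[of _ "insert {a, b} Q"]) auto
qed

text \<open>For a cycle through both edges, one fixed \<open>Q\<close> turns the cycle minus any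
  edge into a basis. The bases obtained by dropping \<open>f\<close> and by dropping
  \<open>e\<close> differ in just these two edges.\<close>

lemma same_block_exchangeable:
  assumes sg: "simple_graph V E" and con: "graph_connected V E" and "same_block E e f"
  shows "(e, f) \<in> (exchangeable V E)\<^sup>*"
proof (cases "e = f")
  case False
  then obtain vs where vs: "3 \<le> length vs" "distinct vs" "cycle_edges vs \<subseteq> E"
    and ef: "e \<in> cycle_edges vs" "f \<in> cycle_edges vs"
    using assms(3) unfolding same_block_def is_cycle_def by blast
  have "g \<subseteq> V" if "g \<in> cycle_edges vs" for g using that vs(3) sg unfolding simple_graph_def by auto
  then have sV: "set vs \<subseteq> V"
    unfolding cycle_edges_def by (auto simp: set_conv_nth)
  have "set vs \<noteq> {}" using vs by auto
  from connected_extension[OF sg con sV this] obtain Q where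
    Q: "Q \<subseteq> E" "card Q \<le> card V - card (set vs)"
    and Qc: "\<And>A. graph_connected (set vs) A \<Longrightarrow> graph_connected V (A \<union> Q)" by blast
  have "cycle_edges vs = (\<lambda>i. {vs ! i, vs ! (Suc i mod length vs)}) ` {..<length vs}"
    unfolding cycle_edges_def by auto
  then have cc: "card (cycle_edges vs) \<le> length vs" "finite (cycle_edges vs)"
    using card_image_le[of "{..<length vs}"] by (metis card_lessThan finite_lessThan, simp)
  have ls: "length vs = card (set vs)" using vs distinct_card by metis
  have finV: "finite V" using sg unfolding simple_graph_def by simp
  have lV: "length vs \<le> card V" unfolding ls using sV finV by (rule card_mono[rotated])
  have basis: "tree_basis V E ((cycle_edges vs - {g}) \<union> Q)" if g: "g \<in> cycle_edges vs" for g
  proof (rule tree_basisI[OF sg])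
    show "cycle_edges vs - {g} \<union> Q \<subseteq> E" using vs Q by auto
    show "graph_connected V (cycle_edges vs - {g} \<union> Q)"
      by (rule Qc[OF cycle_remove_edge_connected[OF vs(1,2) g]])
    have "card (cycle_edges vs - {g}) \<le> length vs - 1" using cc g by simp
    then show "card (cycle_edges vs - {g} \<union> Q) \<le> card V - 1"
      using card_Un_le[of "cycle_edges vs - {g}" Q] Q(2) lV vs(1) ls by linarith
  qed
  \<comment> \<open>Were \<open>g\<close> in \<open>Q\<close>, dropping another cycle edge
    \<open>h\<close> would leave a connected set in which \<open>g\<close> is counted twice, hence
    one with fewer than \<open>card V - 1\<close> edges.\<close>
  have notQ: "g \<notin> Q" if g: "g \<in> cycle_edges vs" for g
  proof
    assume gQ: "g \<in> Q"
    have "\<exists>h. h \<in> cycle_edges vs \<and> h \<noteq> g" using False ef by metis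
    then obtain h where h: "h \<in> cycle_edges vs" "h \<noteq> g" by auto
    have "cycle_edges vs - {h} \<union> Q = (cycle_edges vs - {h, g}) \<union> Q" using gQ by auto
    then have "card (cycle_edges vs - {h} \<union> Q) \<le> card (cycle_edges vs - {h, g}) + card Q"
      by (simp add: card_Un_le)
    moreover have "card (cycle_edges vs - {h, g}) \<le> length vs - 2"
      using h g cc by (simp add: card_Diff_subset)
    ultimately have "card (cycle_edges vs - {h} \<union> Q) < card V - 1"
      using Q(2) lV vs(1) ls by linarith
    then show False using basis[OF h(1)] unfolding tree_basis_def by simp
  qed
  let ?X = "(cycle_edges vs - {e, f}) \<union> Q"
  have "insert e ?X = (cycle_edges vs - {f}) \<union> Q" "insert f ?X = (cycle_edges vs - {e}) \<union> Q"
    using ef False by auto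
  then have "(e, f) \<in> exchangeable V E"
    unfolding exchangeable_def using basis ef notQ by (intro CollectI case_prodI exI[of _ ?X]) auto
  then show ?thesis by auto
qed simp

text \<open>The witness \<open>x\<close> closes a fundamental cycle through \<open>e\<close> and \<open>f\<close>.\<close>

definition share_circuit :: "'a set \<Rightarrow> 'a set set \<Rightarrow> 'a set set \<Rightarrow> ('a set \<times> 'a set) set" where
  "share_circuit V E B = {(e, f). e \<in> B \<and> f \<in> B \<and> (\<exists>x\<in>E - B. x \<subseteq> V \<and>
     graph_connected V (insert x (B - {e})) \<and> graph_connected V (insert x (B - {f})))}"

lemma share_circuit_sym: "(e, f) \<in> (share_circuit V E B)\<^sup>= ^^ d \<Longrightarrow> (f, e) \<in> (share_circuit V E B)\<^sup>= ^^ d"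
proof (induction d arbitrary: e f)
  case (Suc d)
  then obtain g where g: "(e, g) \<in> (share_circuit V E B)\<^sup>= ^^ d" "(g, f) \<in> (share_circuit V E B)\<^sup>=" by auto
  then have "(f, g) \<in> (share_circuit V E B)\<^sup>=" unfolding share_circuit_def by auto
  then show ?case using Suc.IH[OF g(1)] by (rule relpow_Suc_I2)
qed simp

text \<open>The reflexive closure makes the power \<open>d\<close> mean distance at most
  \<open>d\<close>.\<close>

lemma relpow_reflcl_mono: "d \<le> d' \<Longrightarrow> p \<in> R\<^sup>= ^^ d \<Longrightarrow> p \<in> R\<^sup>= ^^ d'"
proof (induction rule: dec_induct)
  case (step n)
  then show ?case by (cases p) (auto intro: relpow_Suc_I)
qed

lemma relpow_reflcl_subset: "R \<subseteq> R' \<Longrightarrow> (e, f) \<in> R\<^sup>= ^^ d \<Longrightarrow> (e, f) \<in> R'\<^sup>= ^^ d"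
proof (induction d arbitrary: f)
  case (Suc d)
  then show ?case by (auto intro: relpow_Suc_I)
qed simp

section \<open>Splitting at a cut vertex\<close>

locale vertex_cut =
  fixes V V1 V2 :: "'a set" and E E1 E2 :: "'a set set" and s :: 'a
  assumes sg: "simple_graph V E"
    and V: "V = V1 \<union> V2" "V1 \<inter> V2 = {s}"
    and E: "E \<subseteq> E1 \<union> E2" and E1: "E1 = {e \<in> E. e \<subseteq> V1}" and E2: "E2 = {e \<in> E. e \<subseteq> V2}"
begin

lemma swap: "vertex_cut V V2 V1 E E2 E1 s"
proof (unfold_locales, rule sg)
  show "V = V2 \<union> V1" "V2 \<inter> V1 = {s}" using V by auto
  show "E \<subseteq> E2 \<union> E1" using E by auto
qed (fact E2, fact E1)

lemma sg1: "simple_graph V1 E1"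
proof -
  have "finite V1" using sg V(1) unfolding simple_graph_def by simp
  then show ?thesis using sg unfolding simple_graph_def E1 by blast
qed

lemma edges_disjoint: "E1 \<inter> E2 = {}"
proof -
  have "e \<notin> E2" if "e \<in> E1" for e
  proof
    assume "e \<in> E2"
    then have "e \<subseteq> {s}" "card e = 2" using that E1 E2 V sg unfolding simple_graph_def by blast+
    then show False by (auto simp: subset_singleton_iff)
  qed
  then show ?thesis by auto
qed

text \<open>Ranks add up because the two sides share one vertex; \<open>s\<close> also keeps both
  sides nonempty, so no subtraction is truncated.\<close>

lemma card_V: "card V - 1 = (card V1 - 1) + (card V2 - 1)"
proof -
  have fin: "finite V1" "finite V2" using sg V unfolding simple_graph_def by auto
  moreover have "V1 \<noteq> {}" "V2 \<noteq> {}" using V by auto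
  ultimately have "0 < card V1" "0 < card V2" by (auto simp: card_gt_0_iff)
  moreover have "card V1 + card V2 = card V + 1" using card_Un_Int[OF fin] V by simp
  ultimately show ?thesis by linarith
qed

lemma restrict_connected:
  assumes "graph_connected V A" "A \<subseteq> E"
  shows "graph_connected V1 (A \<inter> E1)"
proof -
  \<comment> \<open>collapse \<open>V2\<close> to the cut vertex\<close>
  define p where "p v = (if v \<in> V1 then v else s)" for v
  have *: "(p u, p v) \<in> reach (A \<inter> E1)" if "(u, v) \<in> reach A" for u v
    using that
  proof (induction rule: rtrancl_induct)
    case (step y z)
    then have yz: "{y, z} \<in> A" by simp
    then consider "{y, z} \<in> E1" | "{y, z} \<in> E2" using assms E by auto
    then have "(p y, p z) \<in> reach (A \<inter> E1)"
    proof cases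
      case 1
      then show ?thesis using yz E1 unfolding p_def by (auto intro!: reach_edge)
    next
      case 2
      then have "p y = s" "p z = s" using E2 V unfolding p_def by auto
      then show ?thesis by simp
    qed
    with step show ?case by (auto intro: reach_trans)
  qed simp
  show ?thesis
    unfolding graph_connected_def
  proof (intro ballI)
    fix u v assume uv: "u \<in> V1" "v \<in> V1"
    then have "(u, v) \<in> reach A" using V(1) by (intro graph_connectedD[OF assms(1)]) auto
    then show "(u, v) \<in> reach (A \<inter> E1)" using *[of u v] uv by (simp add: p_def)
  qed
qed

lemma restrict_connected2:
  assumes "graph_connected V A" "A \<subseteq> E"
  shows "graph_connected V2 (A \<inter> E2)"
  by (rule vertex_cut.restrict_connected[OF swap assms])

lemma union_connected:
  assumes "graph_connected V1 A1" "graph_connected V2 A2"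
  shows "graph_connected V (A1 \<union> A2)"
proof (rule graph_connectedI[of _ s])
  fix v assume "v \<in> V"
  moreover have "s \<in> V1" "s \<in> V2" using V by auto
  ultimately consider "(s, v) \<in> reach A1" | "(s, v) \<in> reach A2"
    using V graph_connectedD[OF assms(1)] graph_connectedD[OF assms(2)] by auto
  then show "(s, v) \<in> reach (A1 \<union> A2)" by cases (erule reach_mono', simp)+
qed

lemma union_basis:
  assumes "tree_basis V1 E1 A1" "tree_basis V2 E2 A2"
  shows "tree_basis V E (A1 \<union> A2)"
proof (rule tree_basisI[OF sg])
  show "card (A1 \<union> A2) \<le> card V - 1"
    using assms card_Un_le[of A1 A2] card_V unfolding tree_basis_def by simp
  show "A1 \<union> A2 \<subseteq> E" using assms unfolding tree_basis_def E1 E2 by blast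
  show "graph_connected V (A1 \<union> A2)"
    using assms unfolding tree_basis_def by (intro union_connected) auto
qed

text \<open>Both restrictions are connected, so each has at least as many edges as the rank of its
  side. The total is exactly the sum of the ranks, so neither can have more.\<close>

lemma restrict_basis:
  assumes "tree_basis V E A"
  shows "tree_basis V1 E1 (A \<inter> E1)"
proof -
  have A: "A \<subseteq> E" "graph_connected V A" "card A = card V - 1" using assms unfolding tree_basis_def by auto
  have finA: "finite A" using A simple_graph_finite[OF sg] finite_subset by blast
  have "A = (A \<inter> E1) \<union> (A \<inter> E2)" using A E by auto
  moreover have "card ((A \<inter> E1) \<union> (A \<inter> E2)) = card (A \<inter> E1) + card (A \<inter> E2)"
    using finA edges_disjoint by (intro card_Un_disjoint) auto
  ultimately have c: "card (A \<inter> E1) + card (A \<inter> E2) = (card V1 - 1) + (card V2 - 1)"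
    using A card_V by simp
  have "card V2 - 1 \<le> card (A \<inter> E2)"
    using restrict_connected2[OF A(2,1)] simple_graph_subset[OF vertex_cut.sg1[OF swap]]
    by (intro simple_graph_card_ge) auto
  then show ?thesis
    using c restrict_connected[OF A(2,1)] by (intro tree_basisI[OF sg1]) auto
qed

text \<open>All bases have equally many edges in \<open>E1\<close>, so an exchange cannot cross the cut.\<close>

lemma restrict_exchangeable:
  assumes "(e, f) \<in> exchangeable V E" "e \<in> E1"
  shows "f \<in> E1 \<and> (e, f) \<in> exchangeable V1 E1"
proof -
  obtain X where X: "e \<notin> X" "f \<notin> X" "tree_basis V E (insert e X)" "tree_basis V E (insert f X)"
    using assms unfolding exchangeable_def by auto
  have fin: "finite X"
    using X(3) simple_graph_finite[OF sg] finite_subset unfolding tree_basis_def by (metis finite_insert)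
  have b: "tree_basis V1 E1 (insert e X \<inter> E1)" "tree_basis V1 E1 (insert f X \<inter> E1)"
    using X restrict_basis by auto
  have "f \<in> E1"
  proof (rule ccontr)
    assume "f \<notin> E1"
    then have "insert f X \<inter> E1 = X \<inter> E1" "insert e X \<inter> E1 = insert e (X \<inter> E1)" using assms by auto
    then have "card (insert e (X \<inter> E1)) = card (X \<inter> E1)" using b unfolding tree_basis_def by simp
    then show False using X fin by simp
  qed
  moreover have "insert e X \<inter> E1 = insert e (X \<inter> E1)" "insert f X \<inter> E1 = insert f (X \<inter> E1)"
    using assms calculation by auto
  ultimately show ?thesis
    using X b unfolding exchangeable_def by (intro conjI CollectI case_prodI exI[of _ "X \<inter> E1"]) auto
qed

lemma restrict_exchangeable_rtrancl:
  assumes "(e, f) \<in> (exchangeable V E)\<^sup>*" "e \<in> E1"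
  shows "f \<in> E1 \<and> (e, f) \<in> (exchangeable V1 E1)\<^sup>*"
  using assms(1)
proof (induction rule: rtrancl_induct)
  case (step y z)
  then show ?case using restrict_exchangeable by (meson rtrancl.rtrancl_into_rtrancl)
qed (use assms in simp)

lemma share_circuit_lift:
  assumes B: "tree_basis V1 E1 B1" "tree_basis V2 E2 B2"
  shows "share_circuit V1 E1 B1 \<subseteq> share_circuit V E (B1 \<union> B2)"
proof -
  have sub: "B1 \<subseteq> E1" "B2 \<subseteq> E2" and c2: "graph_connected V2 B2" using B unfolding tree_basis_def by auto
  have 1: "graph_connected V (insert x (B1 \<union> B2 - {e}))"
    if "graph_connected V1 (insert x (B1 - {e}))" "e \<in> B1" for x e
  proof -
    have "insert x (B1 - {e}) \<union> B2 = insert x (B1 \<union> B2 - {e})" using that(2) sub edges_disjoint by auto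
    then show ?thesis using union_connected[OF that(1) c2] by simp
  qed
  have 2: "x \<in> E - (B1 \<union> B2) \<and> x \<subseteq> V" if "x \<in> E1 - B1" "x \<subseteq> V1" for x
    using that sub edges_disjoint E1 V by auto
  show ?thesis
  proof (rule subrelI)
    fix e f assume "(e, f) \<in> share_circuit V1 E1 B1"
    then obtain x where ef: "e \<in> B1" "f \<in> B1" and x: "x \<in> E1 - B1" "x \<subseteq> V1"
      "graph_connected V1 (insert x (B1 - {e}))" "graph_connected V1 (insert x (B1 - {f}))"
      unfolding share_circuit_def by auto
    then show "(e, f) \<in> share_circuit V E (B1 \<union> B2)"
      using 1[OF x(3)] 1[OF x(4)] 2[OF x(1,2)] unfolding share_circuit_def by auto
  qed
qed

text \<open>A chain of exchanges that starts on one side stays there, so distances inside that side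
  suffice.\<close>

lemma exchangeable_dist_lift:
  assumes B: "tree_basis V1 E1 B1" "tree_basis V2 E2 B2"
    and dist: "\<And>e f. e \<in> B1 \<Longrightarrow> f \<in> B1 \<Longrightarrow> (e, f) \<in> (exchangeable V1 E1)\<^sup>* \<Longrightarrow>
      \<exists>k. 2 ^ k \<le> 2 * card V1 \<and> (e, f) \<in> (share_circuit V1 E1 B1)\<^sup>= ^^ (2 * k)"
    and e: "e \<in> B1" and f: "f \<in> B1 \<union> B2" and ef: "(e, f) \<in> (exchangeable V E)\<^sup>*"
  shows "\<exists>k. 2 ^ k \<le> 2 * card V \<and> (e, f) \<in> (share_circuit V E (B1 \<union> B2))\<^sup>= ^^ (2 * k)"
proof -
  have sub: "B1 \<subseteq> E1" "B2 \<subseteq> E2" using B unfolding tree_basis_def by auto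
  have *: "f \<in> E1 \<and> (e, f) \<in> (exchangeable V1 E1)\<^sup>*"
    using restrict_exchangeable_rtrancl[OF ef] e sub by auto
  then have "f \<in> B1" using f sub edges_disjoint by auto
  then obtain k where k: "2 ^ k \<le> 2 * card V1" "(e, f) \<in> (share_circuit V1 E1 B1)\<^sup>= ^^ (2 * k)"
    using dist[OF e] * by auto
  have "card V1 \<le> card V" using V sg unfolding simple_graph_def by (auto intro: card_mono)
  moreover have "(e, f) \<in> (share_circuit V E (B1 \<union> B2))\<^sup>= ^^ (2 * k)"
    by (rule relpow_reflcl_subset[OF share_circuit_lift[OF B] k(2)])
  ultimately show ?thesis using k(1) by (intro exI[of _ k]) auto
qed

end


section \<open>Balanced ears\<close>

text \<open>For \<open>v\<close> in the deleted set \<open>S\<close> this is \<open>{v}\<close>;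
  hence the assumption \<open>v \<notin> S\<close> in several facts below.\<close>

definition component :: "'a set set \<Rightarrow> 'a set \<Rightarrow> 'a \<Rightarrow> 'a set" where
  "component E S v = {w. (v, w) \<in> {(x, y). {x, y} \<in> E \<and> x \<notin> S \<and> y \<notin> S}\<^sup>*}"

definition attachments :: "'a set set \<Rightarrow> 'a set \<Rightarrow> 'a set \<Rightarrow> 'a set" where
  "attachments E S K = {y \<in> S. \<exists>z\<in>K. {y, z} \<in> E}"

abbreviation walk :: "'a set set \<Rightarrow> 'a list \<Rightarrow> bool" where
  "walk E \<equiv> successively (\<lambda>x y. {x, y} \<in> E)"

lemma component_self: "v \<in> component E S v"
  unfolding component_def by simp

lemma component_disjoint: "v \<notin> S \<Longrightarrow> component E S v \<inter> S = {}"
proof -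
  assume v: "v \<notin> S"
  have "w \<notin> S" if "(v, w) \<in> {(x, y). {x, y} \<in> E \<and> x \<notin> S \<and> y \<notin> S}\<^sup>*" for w
    using that by (induction rule: rtrancl_induct) (use v in auto)
  then show ?thesis unfolding component_def by blast
qed

lemma component_closed:
  assumes "z \<in> component E S v" "v \<notin> S" "{z, y} \<in> E" "y \<notin> S"
  shows "y \<in> component E S v"
proof -
  have "z \<notin> S" using component_disjoint assms by fastforce
  then show ?thesis using assms unfolding component_def
    by (auto intro: rtrancl.rtrancl_into_rtrancl)
qed

lemma component_least:
  assumes "v \<in> K" "\<And>z y. z \<in> K \<Longrightarrow> {z, y} \<in> E \<Longrightarrow> z \<notin> S \<Longrightarrow> y \<notin> S \<Longrightarrow> y \<in> K"
  shows "component E S v \<subseteq> K"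
proof -
  have "w \<in> K" if "(v, w) \<in> {(x, y). {x, y} \<in> E \<and> x \<notin> S \<and> y \<notin> S}\<^sup>*" for w
    using that by (induction rule: rtrancl_induct) (use assms in auto)
  then show ?thesis unfolding component_def by auto
qed

lemma component_trans:
  "z \<in> component E S v \<Longrightarrow> component E S z \<subseteq> component E S v"
  unfolding component_def by (auto intro: rtrancl_trans)

lemma component_antimono: "S \<subseteq> S' \<Longrightarrow> component E S' v \<subseteq> component E S v"
  unfolding component_def using rtrancl_mono[of "{(x, y). {x, y} \<in> E \<and> x \<notin> S' \<and> y \<notin> S'}"
    "{(x, y). {x, y} \<in> E \<and> x \<notin> S \<and> y \<notin> S}"] by blast

lemma component_sym: "z \<in> component E S v \<Longrightarrow> v \<in> component E S z"
proof -
  have "sym {(x, y). {x, y} \<in> E \<and> x \<notin> S \<and> y \<notin> S}" by (auto simp: sym_def insert_commute)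
  then show "z \<in> component E S v \<Longrightarrow> v \<in> component E S z"
    unfolding component_def mem_Collect_eq by (rule symD[OF sym_rtrancl])
qed

lemma component_path:
  assumes "x \<in> component E S v" "y \<in> component E S v"
  shows "(x, y) \<in> {(x, y). {x, y} \<in> E \<and> x \<notin> S \<and> y \<notin> S}\<^sup>*"
proof -
  have "v \<in> component E S x" using assms component_sym by fast
  then show ?thesis using assms(2) unfolding component_def by (auto intro: rtrancl_trans)
qed

lemma successively_rtrancl:
  "successively (\<lambda>a b. (a, b) \<in> r) L \<Longrightarrow> z \<in> set L \<Longrightarrow> (hd L, z) \<in> r\<^sup>*"
proof (induction L)
  case (Cons a L)
  then show ?case
    by (cases "z = a") (auto simp: successively_Cons intro: converse_rtrancl_into_rtrancl)
qed simp

lemma route_through_component: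
  assumes v: "v \<notin> S" and y: "y1 \<in> attachments E S (component E S v)" "y2 \<in> attachments E S (component E S v)"
  shows "\<exists>R. R \<noteq> [] \<and> distinct R \<and> set R \<subseteq> component E S v \<and> walk E R \<and> {y1, hd R} \<in> E \<and> {last R, y2} \<in> E"
proof -
  let ?K = "component E S v" and ?r = "{(x, y). {x, y} \<in> E \<and> x \<notin> S \<and> y \<notin> S}"
  obtain z1 z2 where z: "z1 \<in> ?K" "z2 \<in> ?K" "{y1, z1} \<in> E" "{y2, z2} \<in> E"
    using y unfolding attachments_def by auto
  from path_list_exists[OF component_path[OF z(1,2)]] obtain R where
    R: "R \<noteq> []" "distinct R" "hd R = z1" "last R = z2" "successively (\<lambda>a b. (a, b) \<in> ?r) R" by blast
  have "set R \<subseteq> ?K"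
  proof
    fix x assume "x \<in> set R"
    then have "(z1, x) \<in> ?r\<^sup>*" using successively_rtrancl[OF R(5)] R(3) by simp
    then show "x \<in> ?K" using z(1) unfolding component_def by (auto intro: rtrancl_trans)
  qed
  moreover have "walk E R" using R(5) by (rule successively_mono) auto
  ultimately show ?thesis using R z by (intro exI[of _ R]) (auto simp: insert_commute)
qed

text \<open>\<open>Q\<close> will be the attachments of a component; the stretch \<open>ys\<close>
  between two consecutive ones is what a rerouted ear can give up.\<close>

lemma split_consecutive:
  assumes "y1 \<in> set L" "y2 \<in> set L" "y1 \<noteq> y2" "y1 \<in> Q" "y2 \<in> Q"
  shows "\<exists>xs a ys b zs. L = xs @ a # ys @ b # zs \<and> a \<in> Q \<and> b \<in> Q \<and> set ys \<inter> Q = {}"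
proof -
  obtain xs a L' where L: "L = xs @ a # L'" "a \<in> Q" "\<forall>x\<in>set xs. x \<notin> Q"
    using split_list_first_prop[of L "\<lambda>x. x \<in> Q"] assms by blast
  then have "\<exists>x\<in>set L'. x \<in> Q" using assms by auto
  then obtain ys b zs where "L' = ys @ b # zs" "b \<in> Q" "\<forall>x\<in>set ys. x \<notin> Q"
    using split_list_first_prop[of L' "\<lambda>x. x \<in> Q"] by blast
  then show ?thesis using L by (intro exI[of _ xs] exI[of _ a] exI[of _ ys] exI[of _ b] exI[of _ zs]) auto
qed

text \<open>For \<open>K\<close> disjoint from \<open>S\<close>, the last conjunct excludes a single
  edge, and with distinctness it forces two different ends.\<close>

definition ear :: "'a set set \<Rightarrow> 'a set \<Rightarrow> 'a set \<Rightarrow> 'a list \<Rightarrow> bool" where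
  "ear E S K L \<longleftrightarrow> distinct L \<and> walk E L \<and> L \<noteq> [] \<and> hd L \<in> S \<and> last L \<in> S \<and>
     set L \<subseteq> {hd L, last L} \<union> K \<and> set L \<inter> K \<noteq> {}"

text \<open>There are two vertex sets because of two uses: \<open>S' = S\<close> for a first ear,
  and \<open>S\<close> enlarged by the vertices of an existing ear when the new one runs through a
  component which that ear leaves.\<close>

lemma ear_through_component:
  assumes v: "v \<notin> S" and K: "component E S v \<subseteq> K" "K \<inter> S' = {}"
    and y: "y1 \<in> attachments E S (component E S v) \<inter> S'" "y2 \<in> attachments E S (component E S v) \<inter> S'" "y1 \<noteq> y2"
  shows "\<exists>L. ear E S' K L \<and> set L \<inter> component E S v \<noteq> {}"
proof -
  obtain R where R: "R \<noteq> []" "distinct R" "set R \<subseteq> component E S v" "walk E R"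
      "{y1, hd R} \<in> E" "{last R, y2} \<in> E"
    using route_through_component[OF v] y by blast
  have "y1 \<notin> set R" "y2 \<notin> set R" using R(3) K y by auto
  moreover have "set R \<inter> K \<noteq> {}" using R(1,3) K(1) by (cases R) auto
  ultimately have "ear E S' K (y1 # R @ [y2])"
    unfolding ear_def using R y K by (auto simp: successively_Cons successively_append_iff)
  moreover have "set (y1 # R @ [y2]) \<inter> component E S v \<noteq> {}" using R by (cases R) auto
  ultimately show ?thesis by blast
qed

text \<open>Absence of cut vertices is stated through unions \<open>K\<close> of components of
  \<open>V - {s}\<close>, so that a violation hands over the two sides \<open>insert s K\<close> and
  \<open>V - K\<close> of a \<open>vertex_cut\<close>.\<close>

locale nonseparable =
  fixes V :: "'a set" and E :: "'a set set"
  assumes sg: "simple_graph V E"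
    and connected: "graph_connected V E"
    and no_cut_vertex: "\<And>s K. s \<in> V \<Longrightarrow> K \<subseteq> V - {s} \<Longrightarrow> K \<noteq> {} \<Longrightarrow>
      (\<forall>e\<in>E. e \<inter> K \<noteq> {} \<longrightarrow> e \<subseteq> insert s K) \<Longrightarrow> K = V - {s}"
begin

lemma finite_V: "finite V"
  using sg unfolding simple_graph_def by simp

lemma component_subset: "v \<in> V \<Longrightarrow> component E S v \<subseteq> V"
  using sg by (intro component_least) (auto simp: simple_graph_def)

lemma finite_component: "v \<in> V \<Longrightarrow> finite (component E S v)"
  using component_subset finite_V finite_subset by metis

text \<open>If \<open>s\<close> were the only attachment, no edge would lead from the component to
  anything but \<open>s\<close>, so the component would be all of \<open>V - {s}\<close>. But it
  avoids \<open>S\<close>, which has a second vertex.\<close>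

lemma two_attachments:
  assumes S: "S \<subseteq> V" "s1 \<in> S" "s2 \<in> S" "s1 \<noteq> s2" and v: "v \<in> V - S"
  shows "\<exists>u w. u \<noteq> w \<and> u \<in> attachments E S (component E S v) \<and> w \<in> attachments E S (component E S v)"
proof (rule ccontr)
  let ?K = "component E S v" and ?N = "attachments E S (component E S v)"
  assume no: "\<not> ?thesis"
  have KS: "?K \<inter> S = {}" using v by (intro component_disjoint) auto
  have "\<exists>s\<in>S. ?N \<subseteq> {s}"
  proof (cases "?N = {}")
    case True
    then show ?thesis using S by auto
  next
    case False
    then obtain s where "s \<in> ?N" by auto
    then show ?thesis using no unfolding attachments_def by blast
  qed
  then obtain s where s: "s \<in> S" "?N \<subseteq> {s}" by auto
  have "e \<subseteq> insert s ?K" if e: "e \<in> E" "e \<inter> ?K \<noteq> {}" for e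
  proof -
    obtain z where z: "z \<in> e" "z \<in> ?K" using e by auto
    have "card e = 2" using e sg unfolding simple_graph_def by auto
    then obtain y where y: "e = {z, y}" using z(1) by (auto simp: card_2_iff)
    show ?thesis
    proof (cases "y \<in> S")
      case True
      then have "y \<in> ?N" using e z y unfolding attachments_def by (auto simp: insert_commute)
      then show ?thesis using s z y by auto
    next
      case False
      then have "y \<in> ?K" using component_closed[OF z(2), of y] v e y by auto
      then show ?thesis using z y by auto
    qed
  qed
  then have "?K = V - {s}"
    using s S v component_subset[of v S] KS component_self[of v E S] by (intro no_cut_vertex) auto
  moreover obtain s' where "s' \<in> S" "s' \<noteq> s" using S by metis
  ultimately show False using KS S by auto
qed

text \<open>Attachments of \<open>K'\<close> in \<open>S\<close> can serve as new ends. Those on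
  \<open>L\<close> inside \<open>K\<close> have to stay on the ear: they are the only exits by which
  a component left by the new ear could reach beyond \<open>K'\<close>.\<close>

lemma ear_reroute:
  assumes S: "S \<subseteq> V" "s1 \<in> S" "s2 \<in> S" "s1 \<noteq> s2" and v: "v \<in> V - S"
    and K: "K = component E S v" and L: "ear E S K L" and v': "v' \<in> K - set L"
    and K': "K' = component E (S \<union> set L) v'"
  shows "\<exists>L2. ear E S K L2 \<and> set L2 \<inter> K' \<noteq> {} \<and> attachments E (S \<union> set L) K' \<inter> set L \<inter> K \<subseteq> set L2"
proof -
  let ?N = "attachments E (S \<union> set L) K'"
  have KS: "K \<inter> S = {}" using v unfolding K by (intro component_disjoint) auto
  have KV: "K \<subseteq> V" using v component_subset unfolding K by auto
  have LV: "set L \<subseteq> V" using L KV S unfolding ear_def by auto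
  have v'S: "v' \<notin> S \<union> set L" "v' \<in> V - (S \<union> set L)" using v' KS KV by auto
  have K'K: "K' \<subseteq> K"
  proof -
    have "K' \<subseteq> component E S v'" unfolding K' by (rule component_antimono) auto
    also have "\<dots> \<subseteq> K" using component_trans v' unfolding K by fast
    finally show ?thesis .
  qed
  have K'S: "K' \<inter> (S \<union> set L) = {}" unfolding K' using v'S(1) by (rule component_disjoint)
  have ear: "distinct L" "walk E L" "L \<noteq> []" "hd L \<in> S" "last L \<in> S" "set L \<subseteq> {hd L, last L} \<union> K"
    using L unfolding ear_def by auto
  obtain u w where uw: "u \<noteq> w" "u \<in> ?N" "w \<in> ?N"
    using two_attachments[of "S \<union> set L" s1 s2 v'] S LV v'S unfolding K' by auto
  have N: "?N \<subseteq> S \<union> set L" unfolding attachments_def by auto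
  show ?thesis
  proof (cases "?N \<inter> K = {}")
    case True
    \<comment> \<open>All attachments lie in \<open>S\<close>, so a fresh ear through
      \<open>K'\<close> is available and nothing of \<open>L\<close> has to be kept.\<close>
    then have "u \<in> S" "w \<in> S" using uw N ear by auto
    then obtain L2 where "ear E S K L2" "set L2 \<inter> K' \<noteq> {}"
      using ear_through_component[OF v'S(1), of E K S u w] uw K'K KS unfolding K' by auto
    then show ?thesis using True by auto
  next
    case False
    then obtain y where y: "y \<in> ?N" "y \<in> K" by auto
    then have yL: "y \<in> set L" "y \<notin> S" using N KS by auto
    show ?thesis
    proof (cases "?N \<inter> set L \<subseteq> {y}")
      case True
      \<comment> \<open>Here \<open>y\<close> is the only attachment on \<open>L\<close>, so another
        one, \<open>h\<close>, lies in \<open>S\<close>. The new ear follows \<open>L\<close> up to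
        \<open>y\<close> and then runs through \<open>K'\<close> to \<open>h\<close>.\<close>
      obtain h where h: "h \<in> ?N" "h \<noteq> y" using uw by metis
      then have hL: "h \<notin> set L" "h \<in> S" using True N by auto
      obtain R where R: "R \<noteq> []" "distinct R" "set R \<subseteq> K'" "walk E R"
          "{y, hd R} \<in> E" "{last R, h} \<in> E"
        using route_through_component[OF v'S(1), of y E h] y h unfolding K' by blast
      obtain xs zs where xz: "L = xs @ y # zs" using yL by (meson split_list)
      \<comment> \<open>\<open>last L\<close> is in \<open>S\<close> and \<open>y\<close> is not, so
        \<open>L\<close> continues beyond \<open>y\<close> and the initial part that is kept misses
        the old end.\<close>
      have "zs \<noteq> []" using ear(5) yL xz by auto
      then have "last L \<in> set zs" using xz by simp
      then have "last L \<notin> set (xs @ [y])" using ear(1) xz by auto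
      moreover have "set (xs @ [y]) \<subseteq> set L" using xz by auto
      ultimately have sub: "set (xs @ [y]) \<subseteq> {hd L} \<union> K" using ear(6) by blast
      let ?L2 = "xs @ y # R @ [h]"
      have hd: "hd ?L2 = hd L" using xz by (simp add: hd_append)
      have RL: "set R \<inter> (S \<union> set L) = {}" using R(3) K'S by auto
      have "distinct ?L2" using ear(1) xz R hL RL by auto
      moreover have "walk E ?L2" using ear(2) xz R by (auto simp: successively_Cons successively_append_iff)
      moreover have "set ?L2 \<subseteq> {hd ?L2, last ?L2} \<union> K" using sub R(3) K'K unfolding hd by auto
      ultimately have "ear E S K ?L2" unfolding ear_def using hd ear(4) hL y by auto
      moreover have "set ?L2 \<inter> K' \<noteq> {}" using R by (cases R) auto
      moreover have "?N \<inter> set L \<inter> K \<subseteq> set ?L2" using True by auto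
      ultimately show ?thesis by blast
    next
      case False
      then obtain y2 where "y2 \<in> set L" "y2 \<in> ?N" "y2 \<noteq> y" by auto
      \<comment> \<open>The detour through \<open>K'\<close> replaces the stretch between two
        consecutive attachments, so no attachment is lost.\<close>
      then obtain xs a ys b zs where xz: "L = xs @ a # ys @ b # zs" and ab: "a \<in> ?N" "b \<in> ?N" "set ys \<inter> ?N = {}"
        using split_consecutive[of y2 L y ?N] yL y by blast
      obtain R where R: "R \<noteq> []" "distinct R" "set R \<subseteq> K'" "walk E R"
          "{a, hd R} \<in> E" "{last R, b} \<in> E"
        using route_through_component[OF v'S(1), of a E b] ab unfolding K' by blast
      let ?L2 = "xs @ a # R @ b # zs"
      have hd: "hd ?L2 = hd L" "last ?L2 = last L" using xz by (auto simp: hd_append)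
      have RL: "set R \<inter> (S \<union> set L) = {}" using R(3) K'S by auto
      have "distinct ?L2" using ear(1) xz R RL by auto
      moreover have "walk E ?L2" using ear(2) xz R by (auto simp: successively_Cons successively_append_iff)
      moreover have "set ?L2 \<subseteq> set L \<union> set R" using xz by auto
      then have "set ?L2 \<subseteq> {hd ?L2, last ?L2} \<union> K" using ear(6) R(3) K'K unfolding hd by blast
      moreover have RK: "set ?L2 \<inter> K' \<noteq> {}" using R by (cases R) auto
      moreover have "set ?L2 \<inter> K \<noteq> {}" using RK K'K by blast
      ultimately have "ear E S K ?L2" unfolding ear_def hd using ear(4,5) by simp
      moreover have "?N \<inter> set L \<inter> K \<subseteq> set ?L2" using xz ab by auto
      ultimately show ?thesis using RK by blast
    qed
  qed
qed

text \<open>The rerouted ear keeps all attachments of the large component \<open>K'\<close>, so whatever it leaves is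
  disjoint from \<open>K'\<close>, hence small, or strictly contained in \<open>K'\<close>.\<close>

lemma balanced_ear_aux:
  assumes S: "S \<subseteq> V" "s1 \<in> S" "s2 \<in> S" "s1 \<noteq> s2" and v: "v \<in> V - S"
    and K: "K = component E S v"
  shows "ear E S K L \<Longrightarrow> v' \<in> K - set L \<Longrightarrow> card K < 2 * card (component E (S \<union> set L) v') \<Longrightarrow>
    \<exists>L. ear E S K L \<and> (\<forall>v'\<in>K - set L. 2 * card (component E (S \<union> set L) v') \<le> card K)"
proof (induction "card (component E (S \<union> set L) v')" arbitrary: L v' rule: less_induct)
  case less
  define K' where "K' = component E (S \<union> set L) v'"
  obtain L2 where L2: "ear E S K L2" "set L2 \<inter> K' \<noteq> {}" "attachments E (S \<union> set L) K' \<inter> set L \<inter> K \<subseteq> set L2"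
    using ear_reroute[OF S v K less(2,3) K'_def] by blast
  have KV: "K \<subseteq> V" using v component_subset unfolding K by auto
  have KS: "K \<inter> S = {}" using v unfolding K by (intro component_disjoint) auto
  have finK: "finite K" using KV finite_V finite_subset by blast
  have comp_sub: "component E T z \<subseteq> K" if "S \<subseteq> T" "z \<in> K" for T z
  proof -
    have "component E T z \<subseteq> component E S z" using that by (intro component_antimono)
    also have "\<dots> \<subseteq> K" using component_trans that(2) unfolding K by fast
    finally show ?thesis .
  qed
  show ?case
  proof (cases "\<forall>z\<in>K - set L2. 2 * card (component E (S \<union> set L2) z) \<le> card K")
    case True
    then show ?thesis using L2 by blast
  next
    case False
    then obtain z where z: "z \<in> K - set L2" "card K < 2 * card (component E (S \<union> set L2) z)" by force
    let ?K'' = "component E (S \<union> set L2) z"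
    \<comment> \<open>Both sets contain more than half of \<open>K\<close>, so they must
      meet.\<close>
    have "?K'' \<inter> K' \<noteq> {}"
    proof
      assume "?K'' \<inter> K' = {}"
      moreover have "?K'' \<subseteq> K" "K' \<subseteq> K" using comp_sub z less(3) unfolding K'_def by auto
      ultimately have "card ?K'' + card K' \<le> card K"
        using finK by (metis Un_least card_Un_disjoint card_mono finite_subset)
      then show False using z(2) less(4) unfolding K'_def by simp
    qed
    then obtain x where x: "x \<in> ?K''" "x \<in> K'" by auto
    have "?K'' \<subseteq> component E (S \<union> set L2) x"
      by (rule component_trans[OF component_sym[OF x(1)]])
    \<comment> \<open>A vertex by which \<open>K'\<close> could be left lies in \<open>K\<close> and
      on the old ear. It is then an attachment of \<open>K'\<close> and was kept on
      \<open>L2\<close>.\<close>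
    also have "\<dots> \<subseteq> K'"
    proof (rule component_least[OF x(2)])
      fix p q assume pq: "p \<in> K'" "{p, q} \<in> E" "p \<notin> S \<union> set L2" "q \<notin> S \<union> set L2"
      show "q \<in> K'"
      proof (rule ccontr)
        assume q: "q \<notin> K'"
        have v'n: "v' \<notin> S \<union> set L" using less(3) KS by auto
        then have qL: "q \<in> set L"
          using component_closed[of p E "S \<union> set L" v' q] pq q unfolding K'_def by auto
        then have "q \<in> attachments E (S \<union> set L) K'"
          using pq unfolding attachments_def by (auto simp: insert_commute)
        moreover have "q \<in> K" using qL less(2) pq unfolding ear_def by auto
        ultimately show False using L2 qL pq by auto
      qed
    qed
    finally have "?K'' \<subseteq> K'" .
    moreover have "?K'' \<inter> (S \<union> set L2) = {}" using z KS by (intro component_disjoint) auto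
    \<comment> \<open>Strict, since \<open>L2\<close> passes through \<open>K'\<close> while
      \<open>?K''\<close> avoids \<open>L2\<close>.\<close>
    ultimately have "?K'' \<subset> K'" using L2 by auto
    moreover have "K' \<subseteq> K" unfolding K'_def using less(3) by (intro comp_sub) auto
    then have "finite K'" using finK by (rule finite_subset)
    ultimately have "card ?K'' < card K'" by (meson psubset_card_mono)
    from less(1)[OF this[unfolded K'_def] L2(1) z] show ?thesis .
  qed
qed

lemma balanced_ear:
  assumes S: "S \<subseteq> V" "s1 \<in> S" "s2 \<in> S" "s1 \<noteq> s2" and v: "v \<in> V - S"
    and K: "K = component E S v"
  shows "\<exists>L. ear E S K L \<and> (\<forall>v'\<in>K - set L. 2 * card (component E (S \<union> set L) v') \<le> card K)"
proof -
  have KS: "K \<inter> S = {}" using v unfolding K by (intro component_disjoint) auto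
  obtain u w where "u \<noteq> w" "u \<in> attachments E S K" "w \<in> attachments E S K"
    using two_attachments[OF S v] unfolding K by blast
  moreover have "attachments E S K \<subseteq> S" unfolding attachments_def by auto
  ultimately obtain L where L: "ear E S K L"
    using ear_through_component[of v S E K S u w] v KS unfolding K by auto
  show ?thesis
  proof (cases "\<forall>v'\<in>K - set L. 2 * card (component E (S \<union> set L) v') \<le> card K")
    case True
    then show ?thesis using L by blast
  next
    case False
    then obtain z where "z \<in> K - set L" "card K < 2 * card (component E (S \<union> set L) z)" by force
    then show ?thesis using balanced_ear_aux[OF S v K L] by blast
  qed
qed

end


section \<open>A spanning tree of logarithmic exchange distance\<close>

text \<open>An ear edge outside \<open>K\<close> would join the two ends directly, so by
  distinctness it would be the whole ear, which then has no vertex in \<open>K\<close>.\<close>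

lemma ear_edge_meets:
  assumes "ear E S K L" "K \<inter> S = {}" "g \<in> path_edges L"
  shows "g \<inter> K \<noteq> {}"
proof
  assume g0: "g \<inter> K = {}"
  obtain xs a b ys where L: "L = xs @ a # b # ys" and g: "g = {a, b}"
    using path_edges_split[OF assms(3)] by blast
  have ear: "distinct L" "set L \<subseteq> {hd L, last L} \<union> K" "set L \<inter> K \<noteq> {}" "hd L \<in> S" "last L \<in> S"
    using assms(1) unfolding ear_def by auto
  have "a \<in> {hd L, last L}" "b \<in> {hd L, last L}" using ear(2) g0 L g by auto
  moreover have "last L \<in> set (b # ys)" "hd L \<in> set (xs @ [a])" using L by (auto simp: hd_append)
  moreover have "a \<notin> set (b # ys)" "b \<notin> set (xs @ [a])" using ear(1) L by auto
  ultimately have ab: "a = hd L" "b = last L" by auto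
  have "xs = []" using ab(1) ear(1) unfolding L by (cases xs) auto
  moreover have "ys = []" using ab(2) ear(1) unfolding L by (cases ys rule: rev_cases) auto
  ultimately have "set L = {a, b}" using L by simp
  moreover have "a \<in> S" "b \<in> S" using ear(4,5) ab by simp_all
  ultimately show False using ear(3) assms(2) by auto
qed

text \<open>Each ear vertex keeps a connection to one of the ends, and both are in \<open>S\<close>.
  Arbitrary \<open>A\<close> and \<open>x\<close> cover the extended tree and the exchanges in it
  alike.\<close>

lemma ear_connected:
  assumes L: "ear E S K L" and x: "x \<in> path_edges L" and A: "graph_connected S A"
  shows "graph_connected (S \<union> set L) (A \<union> (path_edges L - {x}))"
proof (rule graph_connectedI[of _ "hd L"])
  fix v assume v: "v \<in> S \<union> set L"
  have ear: "distinct L" "hd L \<in> S" "last L \<in> S" using L unfolding ear_def by auto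
  have S: "(hd L, z) \<in> reach (A \<union> (path_edges L - {x}))" if "z \<in> S" for z
    by (rule reach_mono'[OF graph_connectedD[OF A ear(2) that]]) auto
  show "(hd L, v) \<in> reach (A \<union> (path_edges L - {x}))"
  proof (cases "v \<in> S")
    case False
    then have "(hd L, v) \<in> reach (path_edges L - {x}) \<or> (last L, v) \<in> reach (path_edges L - {x})"
      using v by (intro reach_path_edges_remove ear x) auto
    then show ?thesis
    proof
      assume "(hd L, v) \<in> reach (path_edges L - {x})"
      then show ?thesis by (rule reach_mono') auto
    next
      assume "(last L, v) \<in> reach (path_edges L - {x})"
      then have "(last L, v) \<in> reach (A \<union> (path_edges L - {x}))" by (rule reach_mono') auto
      then show ?thesis by (rule reach_trans[OF S[OF ear(3)]])
    qed
  qed (rule S)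
qed

text \<open>The ends are old vertices, so the number of new vertices matches the number of ear edges
  after one is dropped.\<close>

lemma ear_card:
  assumes L: "ear E S K L" and "K \<inter> S = {}" "finite S"
  shows "card (S \<union> set L) = card S + (length L - 2)" "3 \<le> length L"
proof -
  have ear: "distinct L" "L \<noteq> []" "set L \<subseteq> {hd L, last L} \<union> K" "set L \<inter> K \<noteq> {}" "hd L \<in> S" "last L \<in> S"
    using assms(1) unfolding ear_def by auto
  obtain p where p: "p \<in> set L" "p \<in> K" using ear by auto
  then obtain a L' where a: "L = a # L'" using ear by (cases L) auto
  have "L' \<noteq> []" using a p ear assms(2) by auto
  then obtain M b where b: "L = a # M @ [b]" using a by (cases L' rule: rev_cases) auto
  have ab: "a \<in> S" "b \<in> S" using ear b by auto
  then have "p \<in> set M" using p b assms(2) by auto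
  then have "M \<noteq> []" by auto
  then show "3 \<le> length L" using b by (cases M) auto
  have "set M \<inter> S = {}" using ear(1,3) b assms(2) by auto
  moreover have "S \<union> set L = S \<union> set M" using b ab by auto
  ultimately have "card (S \<union> set L) = card S + card (set M)" using assms(3) by (simp add: card_Un_disjoint Int_commute)
  then show "card (S \<union> set L) = card S + (length L - 2)" using ear(1) b by (simp add: distinct_card)
qed

text \<open>Any edge of a path from \<open>u\<close> to \<open>w\<close> in \<open>B0\<close> will
  do. Taking it from \<open>B0\<close> and not just from \<open>B\<close> is what will bound its
  distance to the root.\<close>

lemma connected_cut_edge:
  assumes "graph_connected S B" "(u, w) \<in> reach B0" "B0 \<subseteq> B" "u \<noteq> w"
  shows "\<exists>f\<in>B0. \<forall>A. B - {f} \<subseteq> A \<longrightarrow> (u, w) \<in> reach A \<longrightarrow> graph_connected S A"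
proof -
  obtain P where P: "P \<noteq> []" "distinct P" "hd P = u" "last P = w"
      "successively (\<lambda>a b. (a, b) \<in> {(x, y). {x, y} \<in> B0}) P"
    using path_list_exists[OF assms(2)] by blast
  have sub: "path_edges P \<subseteq> B0" using P(5) path_edges_subset_successively[of B0 P] by simp
  have "path_edges P \<noteq> {}" using P assms(4) by (cases P rule: path_edges.cases) auto
  then obtain f where f: "f \<in> path_edges P" by auto
  show ?thesis
  proof (intro bexI[of _ f] allI impI)
    fix A assume A: "B - {f} \<subseteq> A" "(u, w) \<in> reach A"
    show "graph_connected S A"
      by (rule graph_connected_exchange_path[OF assms(1) P(2) _ f _ A(1)]) (use sub assms A P in auto)
  qed (use f sub in auto)
qed

section \<open>Attaching a single ear to a partial tree\<close>

locale ear_extension = nonseparable +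
  fixes S K :: "'a set" and B :: "'a set set" and L :: "'a list" and x :: "'a set" and S' :: "'a set" and B' :: "'a set set"
  assumes SV: "S \<subseteq> V" and KV: "K \<subseteq> V" and KS: "K \<inter> S = {}" and L: "ear E S K L"
    and B: "tree_basis S {e \<in> E. e \<subseteq> S} B"
    and x: "x \<in> path_edges L"
    and S': "S' = S \<union> set L" and B': "B' = B \<union> (path_edges L - {x})"
begin

lemma path_E: "path_edges L \<subseteq> E"
  using L path_edges_subset_successively[of E L] unfolding ear_def by simp

lemma B_facts: "B \<subseteq> E" "\<And>e. e \<in> B \<Longrightarrow> e \<subseteq> S" "graph_connected S B" "card B = card S - 1"
  using B unfolding tree_basis_def by auto

lemma path_not_subset: "g \<in> path_edges L \<Longrightarrow> \<not> g \<subseteq> S"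
  using ear_edge_meets[OF L KS] KS by blast

lemma ends: "hd L \<in> S" "last L \<in> S" "hd L \<noteq> last L" "distinct L"
proof -
  show "hd L \<in> S" "last L \<in> S" "distinct L" using L unfolding ear_def by auto
  have "3 \<le> length L" using ear_card[OF L KS] SV finite_V finite_subset by blast
  then show "hd L \<noteq> last L" using \<open>distinct L\<close> by (cases L) auto
qed

lemma S'V: "S' \<subseteq> V"
  using L SV KV unfolding S' ear_def by auto

lemma sg': "simple_graph S' {e \<in> E. e \<subseteq> S'}"
  using sg S'V finite_subset[OF S'V] unfolding simple_graph_def by auto

lemma basis': "tree_basis S' {e \<in> E. e \<subseteq> S'} B'"
proof (rule tree_basisI[OF sg'])
  show "B' \<subseteq> {e \<in> E. e \<subseteq> S'}"
    using B_facts path_E path_edges_subset[of _ L] unfolding B' S' by blast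
  show "graph_connected S' B'" unfolding S' B' using ear_connected[OF L x B_facts(3)] .
  have fin: "finite S" using SV finite_V finite_subset by blast
  have "card S > 0" using ends fin by (auto simp: card_gt_0_iff)
  moreover have "card B' \<le> card B + card (path_edges L - {x})" unfolding B' by (rule card_Un_le)
  moreover have "card (path_edges L - {x}) = card (path_edges L) - 1" using x by simp
  ultimately show "card B' \<le> card S' - 1"
    using card_path_edges[of L] B_facts(4) ear_card[OF L KS fin] unfolding S' by linarith
qed

text \<open>An old witness lies inside \<open>S\<close>, so it is none of the ear edges and stays
  outside the tree.\<close>

lemma share_circuit_mono: "share_circuit S E B \<subseteq> share_circuit S' E B'"
proof (rule subrelI)
  fix e f assume "(e, f) \<in> share_circuit S E B"
  then obtain y where ef: "e \<in> B" "f \<in> B" and y: "y \<in> E - B" "y \<subseteq> S"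
    "graph_connected S (insert y (B - {e}))" "graph_connected S (insert y (B - {f}))"
    unfolding share_circuit_def by auto
  have "graph_connected S' (insert y (B' - {e}))" if e: "e \<in> B" "graph_connected S (insert y (B - {e}))" for e
  proof -
    have "insert y (B - {e}) \<union> (path_edges L - {x}) = insert y (B' - {e})"
      using path_not_subset B_facts(2)[OF e(1)] unfolding B' by auto
    then show ?thesis using ear_connected[OF L x e(2)] unfolding S' by simp
  qed
  moreover have "y \<in> E - B'" using y path_not_subset unfolding B' by auto
  ultimately show "(e, f) \<in> share_circuit S' E B'"
    using ef y unfolding share_circuit_def S' B' by auto
qed

text \<open>The ear and a path in \<open>B0\<close> between its ends form a cycle whose only edge
  outside the tree is the dropped \<open>x\<close>. So \<open>x\<close> is a common witness for one
  edge \<open>f\<close> of that path and all kept ear edges.\<close>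

lemma new_share_circuit:
  assumes B0: "B0 \<subseteq> B" "(hd L, last L) \<in> reach B0"
  shows "\<exists>f\<in>B0. \<forall>p\<in>path_edges L - {x}. (p, f) \<in> share_circuit S' E B'"
proof -
  obtain f where f: "f \<in> B0" and fc: "\<And>A. B - {f} \<subseteq> A \<Longrightarrow> (hd L, last L) \<in> reach A \<Longrightarrow> graph_connected S A"
    using connected_cut_edge[OF B_facts(3) B0(2,1) ends(3)] by blast
  have xL: "x \<notin> B'" "x \<subseteq> S'" "x \<in> E"
    using x path_not_subset[OF x] B_facts(2) path_edges_subset[OF x] path_E unfolding B' S' by auto
  have fB: "f \<in> B" "f \<notin> path_edges L" using f B0(1) B_facts(2) path_not_subset by blast+
  have hl: "last L \<in> set L" using L unfolding ear_def by auto
  have r: "(hd L, z) \<in> reach ((B - {f}) \<union> path_edges L)" if "z \<in> set L" for z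
    by (rule reach_mono'[OF reach_path_edges[OF that]]) auto
  have gS: "graph_connected S ((B - {f}) \<union> path_edges L)"
    by (rule fc) (use r hl in auto)
  have "graph_connected S' ((B - {f}) \<union> path_edges L)"
  proof (rule graph_connectedI[of _ "hd L"])
    fix v assume "v \<in> S'"
    then show "(hd L, v) \<in> reach ((B - {f}) \<union> path_edges L)"
      using r graph_connectedD[OF gS ends(1)] unfolding S' by blast
  qed
  moreover have "(B - {f}) \<union> path_edges L = insert x (B' - {f})" using fB x unfolding B' by auto
  ultimately have cf: "graph_connected S' (insert x (B' - {f}))" by simp
  have "(p, f) \<in> share_circuit S' E B'" if p: "p \<in> path_edges L - {x}" for p
  proof -
    have "graph_connected S' (B \<union> (path_edges L - {p}))"
      unfolding S' using p by (intro ear_connected[OF L _ B_facts(3)]) auto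
    moreover have "p \<notin> B" using p path_not_subset B_facts(2) by blast
    then have "B \<union> (path_edges L - {p}) = insert x (B' - {p})" using p x unfolding B' by auto
    ultimately have "graph_connected S' (insert x (B' - {p}))" by simp
    moreover have "p \<in> B'" "f \<in> B'" using p fB unfolding B' by auto
    ultimately show ?thesis using cf xL unfolding share_circuit_def by auto
  qed
  then show ?thesis using f by blast
qed

text \<open>The first and the last ear edge meet \<open>K\<close>, but the ends do not lie in
  \<open>K\<close>. So a set linking all attachments of \<open>K\<close> joins the ends.\<close>

lemma ends_attached: "hd L \<in> attachments E S K" "last L \<in> attachments E S K"
proof -
  have fin: "finite S" using SV finite_V finite_subset by blast
  have "3 \<le> length L" using ear_card[OF L KS fin] by simp
  then obtain a p L' where a: "L = a # p # L'" by (cases L rule: path_edges.cases) auto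
  obtain M q b where b: "L = M @ [q, b]" using \<open>3 \<le> length L\<close>
    by (metis append_butlast_last_id append_assoc append_Cons append_Nil butlast.simps(2) a list.distinct(1) butlast_append)
  have "{a, p} \<in> path_edges L" using a by simp
  moreover have "{q, b} \<in> path_edges L" using b path_edges_append[of M q b "[]"] by simp
  ultimately have "{a, p} \<inter> K \<noteq> {}" "{q, b} \<inter> K \<noteq> {}" "{a, p} \<in> E" "{b, q} \<in> E"
    using ear_edge_meets[OF L KS] path_E by (auto simp: insert_commute)
  moreover have "hd L = a" using a by simp
  moreover have "last L = b" using b by simp
  ultimately show "hd L \<in> attachments E S K" "last L \<in> attachments E S K"
    using ends KS unfolding attachments_def by auto
qed

end

section \<open>Growing a tree of small depth by balanced ears\<close>

context nonseparable
begin

text \<open>The edges of \<^term>\<open>B0\<close> have distance at most \<^term>\<open>d\<close> from the root edge \<^term>\<open>r\<close>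
  and already link all vertices to which an ear through \<^term>\<open>K\<close> can be attached.\<close>

definition linked :: "'a set \<Rightarrow> 'a set set \<Rightarrow> 'a set \<Rightarrow> 'a set \<Rightarrow> nat \<Rightarrow> 'a set set \<Rightarrow> bool" where
  "linked S B r K d B0 \<longleftrightarrow> B0 \<subseteq> B \<and> (\<forall>f\<in>B0. (f, r) \<in> (share_circuit S E B)\<^sup>= ^^ d) \<and>
     graph_connected (attachments E S K) B0 \<and> card K * 2 ^ d \<le> card V"

text \<open>\<open>share_circuit\<close> takes the whole of \<open>E\<close>: its requirement that
  the witness be a subset of the vertex set, here \<open>S\<close>, replaces the restriction to
  induced edges made for \<open>tree_basis\<close>.\<close>

definition shallow :: "'a set \<Rightarrow> 'a set set \<Rightarrow> 'a set \<Rightarrow> bool" where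
  "shallow S B r \<longleftrightarrow> S \<subseteq> V \<and> r \<in> B \<and> tree_basis S {e \<in> E. e \<subseteq> S} B \<and>
     (\<forall>f\<in>B. \<exists>d. 2 ^ d \<le> 2 * card V \<and> (f, r) \<in> (share_circuit S E B)\<^sup>= ^^ d) \<and>
     (\<forall>v\<in>V - S. \<exists>d B0. linked S B r (component E S v) d B0)"

text \<open>The product \<open>card K * 2 ^ d\<close> in \<open>linked\<close> is a potential: a
  component left inside \<open>K\<close> has at most half the size at depth one more, and any other
  component keeps its depth without growing.\<close>

lemma shallow_extend:
  assumes sh: "shallow S B r" and v: "v \<in> V - S"
  shows "\<exists>S' B'. S \<subset> S' \<and> shallow S' B' r"
proof -
  have SV: "S \<subseteq> V" and rB: "r \<in> B" and B: "tree_basis S {e \<in> E. e \<subseteq> S} B" 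
    using sh unfolding shallow_def by auto
  define K where "K = component E S v"
  have KV: "K \<subseteq> V" using v component_subset unfolding K_def by auto
  have KS: "K \<inter> S = {}" using v unfolding K_def by (intro component_disjoint) auto
  have "r \<in> E" "r \<subseteq> S" using B rB unfolding tree_basis_def by auto
  then obtain s1 s2 where s: "s1 \<in> S" "s2 \<in> S" "s1 \<noteq> s2"
    using sg unfolding simple_graph_def by (metis card_2_iff insert_subset)
  obtain L where L: "ear E S K L" and half: "\<And>z. z \<in> K - set L \<Longrightarrow> 2 * card (component E (S \<union> set L) z) \<le> card K"
    using balanced_ear[OF SV s v K_def] by blast
  have finS: "finite S" using SV finite_V finite_subset by blast
  have "path_edges L \<noteq> {}" using ear_card[OF L KS finS] by (cases L rule: path_edges.cases) auto
  then obtain x where x: "x \<in> path_edges L" by auto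
  define S' where "S' = S \<union> set L"
  define B' where "B' = B \<union> (path_edges L - {x})"
  interpret ear_extension V E S K B L x S' B'
    by unfold_locales (fact SV KV KS L B x S'_def B'_def)+
  obtain d B0 where "linked S B r K d B0" using sh v unfolding shallow_def K_def by blast
  then have B0: "B0 \<subseteq> B" "\<And>f. f \<in> B0 \<Longrightarrow> (f, r) \<in> (share_circuit S E B)\<^sup>= ^^ d"
    "graph_connected (attachments E S K) B0" "card K * 2 ^ d \<le> card V"
    unfolding linked_def by auto
  have ends0: "(hd L, last L) \<in> reach B0" using graph_connectedD[OF B0(3)] ends_attached by blast
  obtain f0 where f0: "f0 \<in> B0" "\<And>p. p \<in> path_edges L - {x} \<Longrightarrow> (p, f0) \<in> share_circuit S' E B'"
    using new_share_circuit[OF B0(1) ends0] by blast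
  have old: "(f, r) \<in> (share_circuit S' E B')\<^sup>= ^^ k" if "(f, r) \<in> (share_circuit S E B)\<^sup>= ^^ k" for f k
    by (rule relpow_reflcl_subset[OF share_circuit_mono that])
  have new: "(p, r) \<in> (share_circuit S' E B')\<^sup>= ^^ Suc d" if "p \<in> path_edges L - {x}" for p
    by (rule relpow_Suc_I2[OF _ old[OF B0(2)[OF f0(1)]]]) (use f0(2)[OF that] in simp)
  have finK: "finite K" using KV finite_V finite_subset by blast
  \<comment> \<open>As \<open>K\<close> is nonempty, the invariant gives
    \<open>2 ^ d \<le> card V\<close>; the factor 2 in the depth bound pays for the one further unit
    of the new edges.\<close>
  have "v \<in> K" unfolding K_def by (rule component_self)
  then have "1 \<le> card K" using finK by (auto simp: Suc_le_eq card_gt_0_iff)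
  then have "1 * 2 ^ d \<le> card K * 2 ^ d" by (intro mult_right_mono) auto
  then have "1 * 2 ^ d \<le> card V" using B0(4) by (rule le_trans)
  then have d: "2 ^ Suc d \<le> 2 * card V" by simp
  have "\<exists>k. 2 ^ k \<le> 2 * card V \<and> (f, r) \<in> (share_circuit S' E B')\<^sup>= ^^ k" if "f \<in> B'" for f
  proof (cases "f \<in> B")
    case True
    then show ?thesis using sh old unfolding shallow_def by blast
  next
    case False
    then show ?thesis using that new d unfolding B'_def by blast
  qed
  moreover have "\<exists>k A. linked S' B' r (component E S' z) k A" if z: "z \<in> V - S'" for z
  proof (cases "z \<in> K")
    case False
    \<comment> \<open>The new component lies in an old one other than \<open>K\<close>, which has no
      edge to the part of the ear in \<open>K\<close>. Its old linking set therefore still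
      serves.\<close>
    let ?C = "component E S z" and ?C' = "component E S' z"
    have zS: "z \<in> V - S" using z unfolding S'_def by auto
    then obtain k A where kA: "linked S B r ?C k A" using sh unfolding shallow_def by blast
    have sub: "?C' \<subseteq> ?C" by (rule component_antimono) (simp add: S'_def)
    have CK: "?C \<inter> K = {}"
    proof (rule ccontr)
      assume "?C \<inter> K \<noteq> {}"
      then obtain p where p: "p \<in> ?C" "p \<in> K" by auto
      have "z \<in> component E S p" using component_sym[OF p(1)] .
      then have "z \<in> K" using component_trans[of p E S v] p(2) unfolding K_def by blast
      then show False using False by simp
    qed
    have "attachments E S' ?C' \<subseteq> attachments E S ?C"
    proof
      fix y assume "y \<in> attachments E S' ?C'"
      then obtain q where q: "y \<in> S'" "q \<in> ?C'" "{y, q} \<in> E" unfolding attachments_def by auto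
      have "y \<in> S"
      proof (rule ccontr)
        assume "y \<notin> S"
        then have "y \<in> K" using q(1) L unfolding S'_def ear_def by auto
        moreover have "q \<in> ?C" "q \<notin> S" using q sub component_disjoint[of z S E] zS by auto
        ultimately have "q \<in> K" using component_closed[of y E S v q] v q(3) unfolding K_def by auto
        then show False using CK \<open>q \<in> ?C\<close> by auto
      qed
      then show "y \<in> attachments E S ?C" using q sub unfolding attachments_def by auto
    qed
    then have "graph_connected (attachments E S' ?C') A"
      using kA unfolding linked_def graph_connected_def by blast
    moreover have "card ?C' \<le> card ?C" using sub finite_component zS by (intro card_mono) auto
    then have "card ?C' * 2 ^ k \<le> card ?C * 2 ^ k" by (rule mult_right_mono) simp
    then have "card ?C' * 2 ^ k \<le> card V" using kA unfolding linked_def by linarith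
    ultimately have "linked S' B' r ?C' k A"
      using kA old unfolding linked_def B'_def by auto
    then show ?thesis by blast
  next
    case True
    let ?C' = "component E S' z" and ?A = "B0 \<union> (path_edges L - {x})"
    have sub: "?C' \<subseteq> K"
    proof -
      have "?C' \<subseteq> component E S z" by (rule component_antimono) (simp add: S'_def)
      also have "\<dots> \<subseteq> K" using component_trans[of z E S v] True unfolding K_def by simp
      finally show ?thesis .
    qed
    have hdS: "(hd L, y) \<in> reach ?A" if "y \<in> attachments E S K" for y
      by (rule reach_mono'[OF graph_connectedD[OF B0(3) ends_attached(1) that]]) auto
    \<comment> \<open>An attachment is either an old one of \<open>K\<close>, linked by
      \<open>B0\<close>, or an ear vertex, which keeps a connection to an end; the ends are
      attachments of \<open>K\<close> themselves.\<close>
    have "graph_connected (attachments E S' ?C') ?A"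
    proof (rule graph_connectedI[of _ "hd L"])
      fix y assume "y \<in> attachments E S' ?C'"
      then have "y \<in> attachments E S K \<or> y \<in> set L" using sub unfolding attachments_def S'_def by auto
      then show "(hd L, y) \<in> reach ?A"
      proof
        assume "y \<in> set L"
        then consider "(hd L, y) \<in> reach (path_edges L - {x})" | "(last L, y) \<in> reach (path_edges L - {x})"
          using reach_path_edges_remove[OF ends(4) x] by blast
        then show ?thesis
        proof cases
          case 1
          then show ?thesis by (rule reach_mono') auto
        next
          case 2
          then have "(last L, y) \<in> reach ?A" by (rule reach_mono') auto
          then show ?thesis by (rule reach_trans[OF hdS[OF ends_attached(2)]])
        qed
      qed (rule hdS)
    qed
    moreover have "2 * card ?C' \<le> card K" using half[of z] True z unfolding S'_def by auto
    then have "(2 * card ?C') * 2 ^ d \<le> card K * 2 ^ d" by (rule mult_right_mono) simp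
    then have "(2 * card ?C') * 2 ^ d \<le> card V" using B0(4) by (rule le_trans)
    then have "card ?C' * 2 ^ Suc d \<le> card V" by (simp add: ac_simps)
    moreover have "(f, r) \<in> (share_circuit S' E B')\<^sup>= ^^ Suc d" if "f \<in> ?A" for f
    proof (cases "f \<in> B0")
      case True
      then show ?thesis using old[OF B0(2)] by (intro relpow_reflcl_mono[of d "Suc d"]) auto
    qed (use new that in blast)
    ultimately have "linked S' B' r ?C' (Suc d) ?A"
      unfolding linked_def using B0(1) by (auto simp: B'_def simp del: relpow.simps)
    then show ?thesis by blast
  qed
  ultimately have "shallow S' B' r"
    unfolding shallow_def using S'V basis' rB by (auto simp: B'_def)
  moreover have "S \<subset> S'" using L KS unfolding S'_def ear_def by auto
  ultimately show ?thesis by blast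
qed

lemma shallow_complete: "shallow S B r \<Longrightarrow> \<exists>B'. shallow V B' r"
proof (induction "card (V - S)" arbitrary: S B rule: less_induct)
  case less
  show ?case
  proof (cases "S = V")
    case False
    then have "S \<subset> V" using less(2) unfolding shallow_def by auto
    then obtain v where "v \<in> V - S" by auto
    then obtain S' B' where S': "S \<subset> S'" "shallow S' B' r" using shallow_extend[OF less(2)] by blast
    then have "S' \<subseteq> V" unfolding shallow_def by simp
    then have "V - S' \<subset> V - S" using S'(1) by auto
    then have "card (V - S') < card (V - S)" using finite_V by (intro psubset_card_mono) auto
    then show ?thesis using less(1) S'(2) by blast
  qed (use less in auto)
qed

lemma shallow_basis:
  assumes "2 \<le> card V"
  shows "\<exists>B. tree_basis V E B \<and> (\<forall>e\<in>B. \<forall>f\<in>B. \<exists>k. 2 ^ k \<le> 2 * card V \<and>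
    (e, f) \<in> (share_circuit V E B)\<^sup>= ^^ (2 * k))"
proof -
  obtain u w where "u \<in> V" "w \<in> V" "u \<noteq> w"
    using assms finite_V by (metis card_le_Suc0_iff_eq not_less_eq_eq numeral_2_eq_2)
  then obtain s a where sa: "{s, a} \<in> E" "a \<noteq> s"
    using edge_leaving[OF connected, of u "{u}" w] by auto
  let ?S = "{s, a}"
  have SV: "?S \<subseteq> V" using sa sg unfolding simple_graph_def by auto
  have Sc: "graph_connected ?S {?S}"
    by (rule graph_connectedI[of _ s]) (auto intro: reach_edge)
  then have "tree_basis ?S {e \<in> E. e \<subseteq> ?S} {?S}"
    unfolding tree_basis_def using sa by auto
  moreover have "linked ?S {?S} ?S (component E ?S v) 0 {?S}" if "v \<in> V - ?S" for v
  proof -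
    have "card (component E ?S v) \<le> card V"
      using that component_subset finite_V by (intro card_mono) auto
    moreover have "graph_connected (attachments E ?S (component E ?S v)) {?S}"
      using Sc unfolding graph_connected_def attachments_def by blast
    ultimately show ?thesis unfolding linked_def by auto
  qed
  moreover have "2 ^ 0 \<le> 2 * card V" using assms by simp
  ultimately have "shallow ?S {?S} ?S"
    unfolding shallow_def using SV by (auto intro: exI[of _ 0])
  then obtain B where B: "shallow V B ?S" using shallow_complete by blast
  have "{e \<in> E. e \<subseteq> V} = E" using sg unfolding simple_graph_def by auto
  then have "tree_basis V E B" using B unfolding shallow_def by simp
  moreover have "\<exists>k. 2 ^ k \<le> 2 * card V \<and> (e, f) \<in> (share_circuit V E B)\<^sup>= ^^ (2 * k)"
    if ef: "e \<in> B" "f \<in> B" for e f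
  proof -
    obtain d1 d2 where d: "2 ^ d1 \<le> 2 * card V" "(e, ?S) \<in> (share_circuit V E B)\<^sup>= ^^ d1"
       "2 ^ d2 \<le> 2 * card V" "(f, ?S) \<in> (share_circuit V E B)\<^sup>= ^^ d2"
      using B ef unfolding shallow_def by blast
    \<comment> \<open>The way through the root adds both depths; rounding to
      \<open>2 * max d1 d2\<close> lets one exponent carry the bound.\<close>
    have "(e, f) \<in> (share_circuit V E B)\<^sup>= ^^ (d1 + d2)"
      using d(2) share_circuit_sym[OF d(4)] unfolding relpow_add by (rule relcompI)
    then have "(e, f) \<in> (share_circuit V E B)\<^sup>= ^^ (2 * max d1 d2)"
      by (rule relpow_reflcl_mono[rotated]) auto
    moreover have "2 ^ max d1 d2 \<le> 2 * card V" using d by (auto simp: max_def)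
    ultimately show ?thesis by blast
  qed
  ultimately show ?thesis by blast
qed

end

text \<open>The bound is claimed only for pairs related by exchanges. This makes the induction pass
  a cut vertex: related edges lie on the same side, where the bound for a smaller graph
  applies.\<close>

lemma short_distance_basis:
  assumes "simple_graph V E" "graph_connected V E" "V \<noteq> {}"
  shows "\<exists>B. tree_basis V E B \<and> (\<forall>e\<in>B. \<forall>f\<in>B. (e, f) \<in> (exchangeable V E)\<^sup>* \<longrightarrow>
    (\<exists>k. 2 ^ k \<le> 2 * card V \<and> (e, f) \<in> (share_circuit V E B)\<^sup>= ^^ (2 * k)))"
  using assms
proof (induction "card V" arbitrary: V E rule: less_induct)
  case less
  have finV: "finite V" using less.prems unfolding simple_graph_def by simp
  show ?case
  proof (cases "\<exists>s K. s \<in> V \<and> K \<subseteq> V - {s} \<and> K \<noteq> {} \<and> (\<forall>e\<in>E. e \<inter> K \<noteq> {} \<longrightarrow> e \<subseteq> insert s K) \<and> K \<noteq> V - {s}")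
    case True
    then obtain s K where sK: "s \<in> V" "K \<subseteq> V - {s}" "K \<noteq> {}" "K \<noteq> V - {s}"
      and "\<forall>e\<in>E. e \<inter> K \<noteq> {} \<longrightarrow> e \<subseteq> insert s K" by (elim exE conjE) (rule that)
    then have Ke: "e \<inter> K \<noteq> {} \<Longrightarrow> e \<subseteq> insert s K" if "e \<in> E" for e using that by simp
    define V1 where "V1 = insert s K"
    define V2 where "V2 = V - K"
    define E1 where "E1 = {e \<in> E. e \<subseteq> V1}"
    define E2 where "E2 = {e \<in> E. e \<subseteq> V2}"
    have eV: "e \<subseteq> V" if "e \<in> E" for e using that less.prems unfolding simple_graph_def by auto
    interpret c: vertex_cut V V1 V2 E E1 E2 s
    proof unfold_locales
      show "E \<subseteq> E1 \<union> E2" using Ke eV unfolding E1_def E2_def V1_def V2_def by blast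
    qed (use less.prems sK in \<open>auto simp: V1_def V2_def E1_def E2_def\<close>)
    interpret c2: vertex_cut V V2 V1 E E2 E1 s by (rule c.swap)
    have "V1 \<subset> V" "V2 \<subset> V" using sK unfolding V1_def V2_def by auto
    then have lt: "card V1 < card V" "card V2 < card V" using finV by (auto intro: psubset_card_mono)
    have ne: "V1 \<noteq> {}" "V2 \<noteq> {}" using sK unfolding V1_def V2_def by auto
    have "E \<inter> E1 = E1" "E \<inter> E2 = E2" unfolding E1_def E2_def by auto
    then have con: "graph_connected V1 E1" "graph_connected V2 E2"
      using c.restrict_connected[OF less.prems(2)] c2.restrict_connected[OF less.prems(2)] by auto
    obtain B1 where B1: "tree_basis V1 E1 B1" "\<And>e f. e \<in> B1 \<Longrightarrow> f \<in> B1 \<Longrightarrow> (e, f) \<in> (exchangeable V1 E1)\<^sup>* \<Longrightarrow>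
      \<exists>k. 2 ^ k \<le> 2 * card V1 \<and> (e, f) \<in> (share_circuit V1 E1 B1)\<^sup>= ^^ (2 * k)"
      using less(1)[OF lt(1) c.sg1 con(1) ne(1)] by blast
    obtain B2 where B2: "tree_basis V2 E2 B2" "\<And>e f. e \<in> B2 \<Longrightarrow> f \<in> B2 \<Longrightarrow> (e, f) \<in> (exchangeable V2 E2)\<^sup>* \<Longrightarrow>
      \<exists>k. 2 ^ k \<le> 2 * card V2 \<and> (e, f) \<in> (share_circuit V2 E2 B2)\<^sup>= ^^ (2 * k)"
      using less(1)[OF lt(2) c2.sg1 con(2) ne(2)] by blast
    show ?thesis
    proof (intro exI[of _ "B1 \<union> B2"] conjI ballI impI)
      show "tree_basis V E (B1 \<union> B2)" by (rule c.union_basis[OF B1(1) B2(1)])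
      fix e f assume ef: "e \<in> B1 \<union> B2" "f \<in> B1 \<union> B2" "(e, f) \<in> (exchangeable V E)\<^sup>*"
      show "\<exists>k. 2 ^ k \<le> 2 * card V \<and> (e, f) \<in> (share_circuit V E (B1 \<union> B2))\<^sup>= ^^ (2 * k)"
      proof (cases "e \<in> B1")
        case True
        show ?thesis by (rule c.exchangeable_dist_lift[OF B1(1) B2(1) B1(2) True ef(2,3)])
      next
        case False
        then have e: "e \<in> B2" using ef by auto
        have f: "f \<in> B2 \<union> B1" using ef by auto
        show ?thesis using c2.exchangeable_dist_lift[OF B2(1) B1(1) B2(2) e f ef(3)]
          unfolding Un_commute[of B2 B1] by simp
      qed
    qed
  next
    case False
    interpret nonseparable V E
    proof unfold_locales
      fix s K assume sK: "s \<in> V" "K \<subseteq> V - {s}" "K \<noteq> {}" "\<forall>e\<in>E. e \<inter> K \<noteq> {} \<longrightarrow> e \<subseteq> insert s K"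
      show "K = V - {s}"
      proof (rule ccontr)
        assume "K \<noteq> V - {s}"
        with sK have "\<exists>s K. s \<in> V \<and> K \<subseteq> V - {s} \<and> K \<noteq> {} \<and>
            (\<forall>e\<in>E. e \<inter> K \<noteq> {} \<longrightarrow> e \<subseteq> insert s K) \<and> K \<noteq> V - {s}"
          by (intro exI conjI)
        with False show False ..
      qed
    qed (fact less.prems)+
    show ?thesis
    proof (cases "2 \<le> card V")
      case True
      then show ?thesis using shallow_basis by blast
    next
      case False
      then have "card V = 1" using less.prems(3) finV card_gt_0_iff[of V] by linarith
      then obtain v where "V = {v}" by (auto simp: card_1_singleton_iff)
      then have "tree_basis V E {}" unfolding tree_basis_def graph_connected_def by simp
      then show ?thesis by blast
    qed
  qed
qed


section \<open>Moving labels\<close>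

text \<open>The edge count is read off the labelling, a bijection onto
  \<open>{1..card V - 1}\<close>.\<close>

lemma labelled_tree_basis:
  "labelled_spanning_tree V E (B, l) \<Longrightarrow> tree_basis V E B"
  unfolding labelled_spanning_tree_def spanning_tree_def tree_basis_def
  by (auto dest: bij_betw_same_card)

lemma exchange_stepI:
  assumes "simple_graph V E" "e \<in> B" "e' \<in> E - B" "tree_basis V E B'" "B' = insert e' (B - {e})"
    and l': "l' \<in> extensional B'" "l' e' = l e" "\<And>b. b \<in> B - {e} \<Longrightarrow> l' b = l b"
  shows "exchange_step V E (B, l) (B', l')"
proof -
  have "l' = restrict (l(e' := l e)) B'"
    using l' assms(3,5) by (auto simp: fun_eq_iff extensional_def)
  then show ?thesis
    unfolding exchange_step_def using assms tree_basis_spanning_tree[OF assms(1,4)] by auto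
qed

lemma exchange_stepE:
  assumes "exchange_step V E (B, l) t"
  obtains e e' B' l' where "t = (B', l')" "e \<in> B" "e' \<in> E - B" "spanning_tree V E B'" "B' = insert e' (B - {e})"
    "l' \<in> extensional B'" "l' e' = l e" "\<And>b. b \<in> B - {e} \<Longrightarrow> l' b = l b"
proof -
  obtain B' l' where t: "t = (B', l')" by (cases t)
  obtain e e' where e: "e \<in> B" "e' \<in> E - B" "B' = (B - {e}) \<union> {e'}" "spanning_tree V E B'"
      "l' = restrict (l(e' := l e)) B'"
    using assms unfolding t exchange_step_def by auto
  show ?thesis by (rule that[OF t e(1,2,4)]) (use e in auto)
qed

lemma exchange_step_labelled:
  assumes "labelled_spanning_tree V E s" "exchange_step V E s t"
  shows "labelled_spanning_tree V E t"
proof -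
  obtain B l where s: "s = (B, l)" by (cases s)
  obtain e e' B' l' where t: "t = (B', l')" and e: "e \<in> B" "e' \<in> E - B" "spanning_tree V E B'" "B' = insert e' (B - {e})"
    "l' \<in> extensional B'" "l' e' = l e" "\<And>b. b \<in> B - {e} \<Longrightarrow> l' b = l b"
    using assms(2) unfolding s by (rule exchange_stepE) blast
  have bij: "bij_betw l B {1..card V - 1}" using assms(1) unfolding s labelled_spanning_tree_def by auto
  have "bij_betw l' (B - {e}) (l ` (B - {e}))"
    using bij e(7) by (intro bij_betw_imageI) (auto simp: inj_on_def bij_betw_def)
  moreover have "bij_betw l' {e'} {l e}" using e(6) by (auto simp: bij_betw_def)
  moreover have "l ` (B - {e}) \<inter> {l e} = {}" using bij e(1) by (auto simp: bij_betw_def inj_on_def)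
  ultimately have "bij_betw l' ((B - {e}) \<union> {e'}) (l ` (B - {e}) \<union> {l e})" by (rule bij_betw_combine)
  moreover have "l ` (B - {e}) \<union> {l e} = {1..card V - 1}" using bij e(1) by (auto simp: bij_betw_def)
  ultimately show ?thesis using e unfolding t labelled_spanning_tree_def by simp
qed

text \<open>Serves to traverse backwards the route from the second tree to the common one.
  Extensionality makes the original labelling return exactly.\<close>

lemma exchange_step_sym:
  assumes "simple_graph V E" "labelled_spanning_tree V E s" "exchange_step V E s t"
  shows "exchange_step V E t s"
proof -
  obtain B l where s: "s = (B, l)" by (cases s)
  obtain e e' B' l' where t: "t = (B', l')" and e: "e \<in> B" "e' \<in> E - B" "spanning_tree V E B'" "B' = insert e' (B - {e})"
    "l' \<in> extensional B'" "l' e' = l e" "\<And>b. b \<in> B - {e} \<Longrightarrow> l' b = l b"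
    using assms(3) unfolding s by (rule exchange_stepE) blast
  have B: "tree_basis V E B" "l \<in> extensional B" "B \<subseteq> E"
    using assms(2) labelled_tree_basis[of V E B l] unfolding s labelled_spanning_tree_def spanning_tree_def by auto
  show ?thesis unfolding s t
  proof (rule exchange_stepI[OF assms(1), of e' _ e])
    show "l b = l' b" if "b \<in> B' - {e'}" for b using e(7)[of b] that e(2,4) by auto
  qed (use e B in auto)
qed

lemma exchange_steps_labelled:
  assumes "labelled_spanning_tree V E s" "(exchange_step V E ^^ k) s t"
  shows "labelled_spanning_tree V E t"
  using assms(2)
proof (induction k arbitrary: t)
  case (Suc k)
  then obtain u where "(exchange_step V E ^^ k) s u" "exchange_step V E u t" by (auto simp: relcompp.simps)
  then show ?case using Suc.IH exchange_step_labelled by blast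
qed (use assms in auto)

lemma exchange_steps_sym:
  assumes "simple_graph V E" "labelled_spanning_tree V E s" "(exchange_step V E ^^ k) s t"
  shows "(exchange_step V E ^^ k) t s"
  using assms(3)
proof (induction k arbitrary: t)
  case (Suc k)
  then obtain u where u: "(exchange_step V E ^^ k) s u" "exchange_step V E u t" by (auto simp: relcompp.simps)
  have "exchange_step V E t u"
    by (rule exchange_step_sym[OF assms(1) exchange_steps_labelled[OF assms(2) u(1)] u(2)])
  then show ?case using Suc.IH[OF u(1)] by (rule relpowp_Suc_I2)
qed auto

lemma relpowp_trans: "(R ^^ i) x y \<Longrightarrow> (R ^^ j) y z \<Longrightarrow> (R ^^ (i + j)) x z"
  unfolding relpowp_add by (rule relcomppI)

lemma swap_labels_adjacent:
  assumes sg: "simple_graph V E" and lab: "labelled_spanning_tree V E (B, l)"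
    and sc: "(e, f) \<in> share_circuit V E B" and ef: "e \<noteq> f"
  shows "(exchange_step V E ^^ 3) (B, l) (B, l(e := l f, f := l e))"
proof -
  have B: "tree_basis V E B" by (rule labelled_tree_basis[OF lab])
  have l: "l \<in> extensional B" using lab unfolding labelled_spanning_tree_def by auto
  have BE: "B \<subseteq> E" and cB: "card B = card V - 1" using B unfolding tree_basis_def by auto
  have finB: "finite B" using BE simple_graph_finite[OF sg] finite_subset by blast
  obtain x where eB: "e \<in> B" "f \<in> B" and x: "x \<in> E" "x \<notin> B"
    "graph_connected V (insert x (B - {e}))" "graph_connected V (insert x (B - {f}))"
    using sc unfolding share_circuit_def by auto
  have basis: "tree_basis V E (insert x (B - {g}))" if "g \<in> B" "graph_connected V (insert x (B - {g}))" for g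
  proof (rule tree_basisI[OF sg _ that(2)])
    show "card (insert x (B - {g})) \<le> card V - 1"
      using that(1) x finB cB card_Suc_Diff1[OF finB that(1)] by simp
  qed (use x BE in auto)
  \<comment> \<open>In turn, \<open>x\<close> takes over the label of \<open>e\<close>,
    \<open>e\<close> returns with the label of \<open>f\<close>, and \<open>f\<close> returns with
    the label parked on \<open>x\<close>. Edges outside the tree carry \<open>undefined\<close>, as
    labellings are extensional.\<close>
  let ?B1 = "insert x (B - {e})" and ?B2 = "insert x (B - {f})"
  let ?l1 = "l(x := l e, e := undefined)" and ?l2 = "l(x := l e, e := l f, f := undefined)"
  have ext: "l b = undefined" if "b \<notin> B" for b using l that by (auto simp: extensional_def)
  have "exchange_step V E (B, l) (?B1, ?l1)"
    by (rule exchange_stepI[OF sg eB(1), of x]) (use x eB basis ef ext in \<open>auto simp: extensional_def\<close>)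
  moreover have "exchange_step V E (?B1, ?l1) (?B2, ?l2)"
    by (rule exchange_stepI[OF sg, of f _ e]) (use x eB basis ef ext BE in \<open>auto simp: extensional_def\<close>)
  moreover have "exchange_step V E (?B2, ?l2) (B, l(e := l f, f := l e))"
    by (rule exchange_stepI[OF sg, of x _ f]) (use x eB B ef ext BE in \<open>auto simp: extensional_def\<close>)
  ultimately show ?thesis by (auto simp: numeral_3_eq_3 relcompp.simps)
qed

text \<open>Along a chain the transposition \<open>(e f)\<close> is the conjugate of \<open>(e g)\<close> by \<open>(g f)\<close>.\<close>

lemma swap_labels:
  assumes sg: "simple_graph V E" and "(e, f) \<in> (share_circuit V E B)\<^sup>= ^^ k"
  shows "labelled_spanning_tree V E (B, l) \<Longrightarrow>
    \<exists>j\<le>6 * k. (exchange_step V E ^^ j) (B, l) (B, l(e := l f, f := l e))"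
  using assms(2)
proof (induction k arbitrary: f l)
  case 0
  then show ?case by auto
next
  case (Suc k)
  then obtain g where eg: "(e, g) \<in> (share_circuit V E B)\<^sup>= ^^ k" and gf: "(g, f) \<in> (share_circuit V E B)\<^sup>="
    by auto
  let ?l = "\<lambda>l a b. l(a := l b, b := l a)"
  consider "g = f" | "e = f" | "e = g" "g \<noteq> f" | "e \<noteq> f" "e \<noteq> g" "g \<noteq> f" by blast
  then show ?case
  proof cases
    case 1
    then obtain j where j: "j \<le> 6 * k" "(exchange_step V E ^^ j) (B, l) (B, ?l l e f)"
      using Suc.IH[OF Suc.prems(1) eg] by blast
    then have "j \<le> 6 * Suc k" by simp
    then show ?thesis using j(2) by blast
  next
    case 2
    then show ?thesis by (intro exI[of _ 0]) auto
  next
    case 3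
    then have "(g, f) \<in> share_circuit V E B" using gf by blast
    then have "(exchange_step V E ^^ 3) (B, l) (B, ?l l e f)"
      using swap_labels_adjacent[OF sg Suc.prems(1)] 3 by simp
    moreover have "3 \<le> 6 * Suc k" by simp
    ultimately show ?thesis by blast
  next
    case 4
    have gf': "(g, f) \<in> share_circuit V E B" using gf 4 by auto
    let ?l1 = "?l l g f"
    let ?l2 = "?l ?l1 e g"
    have s1: "(exchange_step V E ^^ 3) (B, l) (B, ?l1)"
      by (rule swap_labels_adjacent[OF sg Suc.prems(1) gf' 4(3)])
    have lab1: "labelled_spanning_tree V E (B, ?l1)" by (rule exchange_steps_labelled[OF Suc.prems(1) s1])
    obtain j where j: "j \<le> 6 * k" "(exchange_step V E ^^ j) (B, ?l1) (B, ?l2)"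
      using Suc.IH[OF lab1 eg] by blast
    have lab2: "labelled_spanning_tree V E (B, ?l2)" by (rule exchange_steps_labelled[OF lab1 j(2)])
    have s3: "(exchange_step V E ^^ 3) (B, ?l2) (B, ?l ?l2 g f)"
      by (rule swap_labels_adjacent[OF sg lab2 gf' 4(3)])
    have "?l ?l2 g f = ?l l e f" using 4 by (auto simp: fun_eq_iff)
    then have "(exchange_step V E ^^ (3 + j + 3)) (B, l) (B, ?l l e f)"
      using relpowp_trans[OF relpowp_trans[OF s1 j(2)] s3] by simp
    \<comment> \<open>Two adjacent swaps of three exchanges enclose the recursive one: six exchanges
      per unit of distance.\<close>
    moreover have "3 + j + 3 \<le> 6 * Suc k" using j(1) by simp
    ultimately show ?thesis by blast
  qed
qed

text \<open>Each swap puts the right label on \<open>f\<close> and spoils nothing, since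
  \<open>e\<close> and \<open>f\<close> were both wrong. As these two edges are related, equally
  labelled edges stay related after the swap.\<close>

lemma sort_labels:
  assumes sg: "simple_graph V E" and lab': "labelled_spanning_tree V E (B, l')"
    and dist: "\<And>e f. e \<in> B \<Longrightarrow> f \<in> B \<Longrightarrow> (e, f) \<in> (exchangeable V E)\<^sup>* \<Longrightarrow>
      (e, f) \<in> (share_circuit V E B)\<^sup>= ^^ D"
  shows "labelled_spanning_tree V E (B, l) \<Longrightarrow>
    (\<And>e f. e \<in> B \<Longrightarrow> f \<in> B \<Longrightarrow> l e = l' f \<Longrightarrow> (e, f) \<in> (exchangeable V E)\<^sup>*) \<Longrightarrow>
    \<exists>j\<le>card {e \<in> B. l e \<noteq> l' e} * (6 * D). (exchange_step V E ^^ j) (B, l) (B, l')"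
proof (induction "card {e \<in> B. l e \<noteq> l' e}" arbitrary: l rule: less_induct)
  case less
  have l: "l \<in> extensional B" "bij_betw l B {1..card V - 1}"
    and l': "l' \<in> extensional B" "bij_betw l' B {1..card V - 1}"
    using less.prems(1) lab' unfolding labelled_spanning_tree_def by auto
  have finB: "finite B" using l(2) bij_betw_finite by blast
  show ?case
  proof (cases "\<forall>e\<in>B. l e = l' e")
    case True
    then have "l = l'" using l l' by (metis extensionalityI)
    then show ?thesis by (intro exI[of _ 0]) auto
  next
    case False
    then obtain e where e: "e \<in> B" "l e \<noteq> l' e" by auto
    have "l e \<in> l' ` B" using l(2) l'(2) e(1) by (auto simp: bij_betw_def)
    then obtain f where f: "f \<in> B" "l' f = l e" by auto
    have ef: "e \<noteq> f" using e f by auto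
    have inj: "l a = l b \<Longrightarrow> a = b" if "a \<in> B" "b \<in> B" for a b
      using l(2) that by (auto simp: bij_betw_def inj_on_def)
    have lf: "l f \<noteq> l' f" using inj[of e f] e f ef by auto
    let ?l1 = "l(e := l f, f := l e)"
    have eqv: "(e, f) \<in> (exchangeable V E)\<^sup>*" using less.prems(2)[OF e(1) f(1)] f(2) by simp
    obtain j where j: "j \<le> 6 * D" "(exchange_step V E ^^ j) (B, l) (B, ?l1)"
      using swap_labels[OF sg dist[OF e(1) f(1) eqv] less.prems(1)] by blast
    have lab1: "labelled_spanning_tree V E (B, ?l1)" by (rule exchange_steps_labelled[OF less.prems(1) j(2)])
    have "{a \<in> B. ?l1 a \<noteq> l' a} \<subseteq> {a \<in> B. l a \<noteq> l' a} - {f}" using e f lf ef by auto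
    moreover have "f \<in> {a \<in> B. l a \<noteq> l' a}" using f(1) lf by simp
    ultimately have "{a \<in> B. ?l1 a \<noteq> l' a} \<subset> {a \<in> B. l a \<noteq> l' a}" by blast
    then have lt: "card {a \<in> B. ?l1 a \<noteq> l' a} < card {a \<in> B. l a \<noteq> l' a}"
      using finB by (intro psubset_card_mono) auto
    have "(a, b) \<in> (exchangeable V E)\<^sup>*" if ab: "a \<in> B" "b \<in> B" "?l1 a = l' b" for a b
    proof -
      consider "a = f" | "a = e" | "a \<noteq> e" "a \<noteq> f" by blast
      then show ?thesis
      proof cases
        case 1
        then have "l e = l' b" using ab(3) by simp
        then have "(e, b) \<in> (exchangeable V E)\<^sup>*" using less.prems(2)[OF e(1) ab(2)] by simp
        then show ?thesis using exchangeable_rtrancl_sym[OF eqv] 1 by (auto intro: rtrancl_trans)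
      next
        case 2
        then have "l f = l' b" using ab(3) ef by simp
        then have "(f, b) \<in> (exchangeable V E)\<^sup>*" using less.prems(2)[OF f(1) ab(2)] by simp
        then show ?thesis using eqv 2 by (auto intro: rtrancl_trans)
      next
        case 3
        then show ?thesis using less.prems(2)[OF ab(1,2)] ab(3) by simp
      qed
    qed
    from less(1)[OF lt lab1 this] obtain i where
      i: "i \<le> card {a \<in> B. ?l1 a \<noteq> l' a} * (6 * D)" "(exchange_step V E ^^ i) (B, ?l1) (B, l')" by blast
    have "j + i \<le> (card {a \<in> B. ?l1 a \<noteq> l' a} + 1) * (6 * D)" using i(1) j(1) by simp
    also have "\<dots> \<le> card {a \<in> B. l a \<noteq> l' a} * (6 * D)" using lt by (intro mult_right_mono) auto
    finally show ?thesis using relpowp_trans[OF j(2) i(2)] by blast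
  qed
qed

text \<open>The path in \<open>B1\<close> between the ends of \<open>x\<close> cannot lie in
  \<open>B\<close>, where \<open>x\<close> would then be redundant against the edge count. Any of
  its edges outside \<open>B\<close> can be traded for \<open>x\<close>.\<close>

lemma basis_exchange:
  assumes sg: "simple_graph V E" and B: "tree_basis V E B" and B1: "tree_basis V E B1"
    and x: "x \<in> B - B1"
  shows "\<exists>e\<in>B1 - B. tree_basis V E (insert x (B1 - {e}))"
proof -
  have BE: "B \<subseteq> E" "graph_connected V B" "card B = card V - 1" "B1 \<subseteq> E" "graph_connected V B1" "card B1 = card V - 1"
    using B B1 unfolding tree_basis_def by auto
  have fin: "finite B" "finite B1" using BE simple_graph_finite[OF sg] finite_subset by blast+
  have "x \<subseteq> V" "card x = 2" using x BE sg unfolding simple_graph_def by auto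
  then obtain a b where ab: "x = {a, b}" "a \<in> V" "b \<in> V" by (auto simp: card_2_iff)
  obtain P where P: "P \<noteq> []" "distinct P" "hd P = a" "last P = b"
      "successively (\<lambda>a b. (a, b) \<in> {(x, y). {x, y} \<in> B1}) P"
    using path_list_exists[OF graph_connectedD[OF BE(5) ab(2,3)]] by blast
  have PB1: "path_edges P \<subseteq> B1" using P(5) path_edges_subset_successively[of B1 P] by simp
  have "\<not> path_edges P \<subseteq> B"
  proof
    assume sub: "path_edges P \<subseteq> B"
    then have "path_edges P \<subseteq> B - {x}" using PB1 x by auto
    moreover have "b \<in> set P" using P by auto
    then have "(a, b) \<in> reach (path_edges P)" using reach_path_edges[of b P] P by simp
    ultimately have r: "(a, b) \<in> reach (B - {x})" by (rule reach_mono'[rotated])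
    have "(u, v) \<in> reach (B - {x})" if uv: "{u, v} \<in> B" for u v
    proof (cases "{u, v} = x")
      case True
      then have "u = a \<and> v = b \<or> u = b \<and> v = a" using ab by (auto simp: doubleton_eq_iff)
      then show ?thesis using r reach_sym[OF r] by auto
    qed (use uv in auto)
    then have "graph_connected V (B - {x})"
      using BE(2) unfolding graph_connected_def by (blast intro: reach_subst)
    then have "card V - 1 \<le> card (B - {x})"
      using simple_graph_subset[OF sg, of "B - {x}"] BE(1) by (intro simple_graph_card_ge) auto
    moreover have "card (B - {x}) < card B" using fin x by (intro card_Diff1_less) auto
    ultimately show False using BE(3) by simp
  qed
  then obtain e where e: "e \<in> path_edges P" "e \<notin> B" by auto
  have "graph_connected V (insert x (B1 - {e}))"
    by (rule graph_connected_exchange_path[OF BE(5) P(2) PB1 e(1)]) (use ab P in \<open>auto intro: reach_edge\<close>)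
  moreover have "e \<in> B1" using e PB1 by auto
  moreover have "card (insert x (B1 - {e})) = card B1"
    using \<open>e \<in> B1\<close> x fin card_Suc_Diff1[of B1 e] by simp
  ultimately have "tree_basis V E (insert x (B1 - {e}))"
    using x BE by (intro tree_basisI[OF sg]) auto
  then show ?thesis using e \<open>e \<in> B1\<close> by blast
qed

text \<open>Each exchange brings in an edge of \<open>B\<close> and discards an edge outside it. It
  also relates the edge that gives up a label to the one that receives it; composing these relations
  follows the label to its final bearer.\<close>

lemma reconfigure_to_basis:
  assumes sg: "simple_graph V E" and B: "tree_basis V E B"
  shows "labelled_spanning_tree V E (B1, l1) \<Longrightarrow>
    \<exists>l. (exchange_step V E ^^ card (B - B1)) (B1, l1) (B, l) \<and>
      (\<forall>e\<in>B1. \<exists>f\<in>B. l f = l1 e \<and> (e, f) \<in> (exchangeable V E)\<^sup>*)"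
proof (induction "card (B - B1)" arbitrary: B1 l1)
  case 0
  have B1: "tree_basis V E B1" by (rule labelled_tree_basis[OF 0(2)])
  have fin: "finite B" "finite B1"
    using B B1 simple_graph_finite[OF sg] finite_subset unfolding tree_basis_def by blast+
  then have "B \<subseteq> B1" using 0(1) by auto
  then have "B = B1" using B B1 fin card_subset_eq unfolding tree_basis_def by metis
  then show ?case by (intro exI[of _ l1]) auto
next
  case (Suc n)
  have B1: "tree_basis V E B1" by (rule labelled_tree_basis[OF Suc(3)])
  have fin: "finite B"
    using B simple_graph_finite[OF sg] finite_subset unfolding tree_basis_def by blast
  have "B - B1 \<noteq> {}" using Suc(2) by (metis card.empty nat.distinct(1))
  then obtain x where x: "x \<in> B - B1" by auto
  obtain e where e: "e \<in> B1 - B" "tree_basis V E (insert x (B1 - {e}))"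
    using basis_exchange[OF sg B B1 x] by blast
  let ?B2 = "insert x (B1 - {e})" and ?l2 = "l1(x := l1 e, e := undefined)"
  have l1: "l1 \<in> extensional B1" using Suc(3) unfolding labelled_spanning_tree_def by auto
  have step: "exchange_step V E (B1, l1) (?B2, ?l2)"
    by (rule exchange_stepI[OF sg, of e _ x]) (use x e B l1 in \<open>auto simp: extensional_def tree_basis_def\<close>)
  have lab2: "labelled_spanning_tree V E (?B2, ?l2)" by (rule exchange_step_labelled[OF Suc(3) step])
  have "B - B1 = insert x (B - ?B2)" using x e by auto
  then have "card (B - B1) = Suc (card (B - ?B2))" using fin by simp
  then have n: "n = card (B - ?B2)" using Suc(2) by simp
  from Suc(1)[OF n lab2] obtain l where
    l: "(exchange_step V E ^^ n) (?B2, ?l2) (B, l)"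
      "\<And>g. g \<in> ?B2 \<Longrightarrow> \<exists>f\<in>B. l f = ?l2 g \<and> (g, f) \<in> (exchangeable V E)\<^sup>*"
    unfolding n[symmetric] by blast
  have "insert e (B1 - {e}) = B1" using e by auto
  then have ex: "(e, x) \<in> exchangeable V E"
    unfolding exchangeable_def using B1 e x by (intro CollectI case_prodI exI[of _ "B1 - {e}"]) auto
  have "\<exists>f\<in>B. l f = l1 g \<and> (g, f) \<in> (exchangeable V E)\<^sup>*" if g: "g \<in> B1" for g
  proof (cases "g = e")
    case True
    obtain f where f: "f \<in> B" "l f = ?l2 x" "(x, f) \<in> (exchangeable V E)\<^sup>*" using l(2)[of x] by auto
    have "x \<noteq> e" using x e by auto
    then have "l f = l1 g" using f(2) True by simp
    moreover have "(g, f) \<in> (exchangeable V E)\<^sup>*"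
      using ex f(3) True by (auto intro: converse_rtrancl_into_rtrancl)
    ultimately show ?thesis using f(1) by blast
  next
    case False
    then have "g \<in> ?B2" "g \<noteq> x" using g x by auto
    then show ?thesis using l(2)[of g] False by simp
  qed
  moreover have "(exchange_step V E ^^ Suc n) (B1, l1) (B, l)" using step l(1) by (rule relpowp_Suc_I2)
  ultimately show ?case using Suc(2) by metis
qed

lemma reconfigure:
  assumes sg: "simple_graph V E" and V: "V \<noteq> {}"
    and lab1: "labelled_spanning_tree V E (B1, l1)" and lab2: "labelled_spanning_tree V E (B2, l2)"
    and blocks: "\<And>i. i \<in> {1..card V - 1} \<Longrightarrow> same_block E (inv_into B1 l1 i) (inv_into B2 l2 i)"
  shows "\<exists>k. real k \<le> 14 * real (card V) + 12 * real (card V) * log 2 (real (card V)) \<and>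
    (exchange_step V E ^^ k) (B1, l1) (B2, l2)"
proof -
  let ?n = "card V"
  have n: "0 < ?n" using V sg unfolding simple_graph_def by (auto simp: card_gt_0_iff)
  have con: "graph_connected V E"
    using labelled_tree_basis[OF lab1] graph_connected_mono unfolding tree_basis_def by blast
  obtain B where B: "tree_basis V E B" and short: "\<And>e f. e \<in> B \<Longrightarrow> f \<in> B \<Longrightarrow> (e, f) \<in> (exchangeable V E)\<^sup>* \<Longrightarrow>
    \<exists>k. 2 ^ k \<le> 2 * ?n \<and> (e, f) \<in> (share_circuit V E B)\<^sup>= ^^ (2 * k)"
    using short_distance_basis[OF sg con V] by blast
  define m where "m = nat \<lfloor>log 2 (real (2 * ?n))\<rfloor>"
  have dist: "(e, f) \<in> (share_circuit V E B)\<^sup>= ^^ (2 * m)"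
    if ef: "e \<in> B" "f \<in> B" "(e, f) \<in> (exchangeable V E)\<^sup>*" for e f
  proof -
    obtain k where k: "2 ^ k \<le> 2 * ?n" "(e, f) \<in> (share_circuit V E B)\<^sup>= ^^ (2 * k)" using short[OF ef] by blast
    have "real k \<le> log 2 (real (2 * ?n))" using k(1) by (intro le_log2_of_power) 
    then have "k \<le> m" unfolding m_def by (simp add: le_nat_floor)
    then show ?thesis by (intro relpow_reflcl_mono[OF _ k(2)]) simp
  qed
  obtain l where l: "(exchange_step V E ^^ card (B - B1)) (B1, l1) (B, l)"
      "\<And>e. e \<in> B1 \<Longrightarrow> \<exists>f\<in>B. l f = l1 e \<and> (e, f) \<in> (exchangeable V E)\<^sup>*"
    using reconfigure_to_basis[OF sg B lab1] by blast
  obtain l' where l': "(exchange_step V E ^^ card (B - B2)) (B2, l2) (B, l')"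
      "\<And>e. e \<in> B2 \<Longrightarrow> \<exists>f\<in>B. l' f = l2 e \<and> (e, f) \<in> (exchangeable V E)\<^sup>*"
    using reconfigure_to_basis[OF sg B lab2] by blast
  have lab: "labelled_spanning_tree V E (B, l)" "labelled_spanning_tree V E (B, l')"
    using exchange_steps_labelled[OF lab1 l(1)] exchange_steps_labelled[OF lab2 l'(1)] by auto
  have bij: "bij_betw l1 B1 {1..?n - 1}" "bij_betw l2 B2 {1..?n - 1}"
      "bij_betw l B {1..?n - 1}" "bij_betw l' B {1..?n - 1}"
    using lab lab1 lab2 unfolding labelled_spanning_tree_def by auto
  \<comment> \<open>The label is traced back to its edges \<open>e1\<close> and \<open>e2\<close> in
    the two given trees, which share a block, and forward again to \<open>e\<close> and
    \<open>f\<close>.\<close>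
  have "(e, f) \<in> (exchangeable V E)\<^sup>*" if ef: "e \<in> B" "f \<in> B" "l e = l' f" for e f
  proof -
    let ?i = "l e"
    have i: "?i \<in> {1..?n - 1}" using bij(3) ef(1) by (auto simp: bij_betw_def)
    define e1 where "e1 = inv_into B1 l1 ?i"
    define e2 where "e2 = inv_into B2 l2 ?i"
    have e1: "e1 \<in> B1" "l1 e1 = ?i" and e2: "e2 \<in> B2" "l2 e2 = ?i"
      using i bij(1,2) unfolding e1_def e2_def bij_betw_def
      by (auto intro: inv_into_into f_inv_into_f)
    have inj: "inj_on l B" "inj_on l' B" using bij(3,4) by (auto simp: bij_betw_def)
    have 1: "(e1, e) \<in> (exchangeable V E)\<^sup>*"
      using l(2)[OF e1(1)] inj_onD[OF inj(1)] ef(1) unfolding e1(2) by blast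
    have 2: "(e2, f) \<in> (exchangeable V E)\<^sup>*"
      using l'(2)[OF e2(1)] inj_onD[OF inj(2)] ef(2) unfolding e2(2) ef(3) by blast
    have "(e1, e2) \<in> (exchangeable V E)\<^sup>*"
      unfolding e1_def e2_def by (rule same_block_exchangeable[OF sg con blocks[OF i]])
    then show ?thesis using exchangeable_rtrancl_sym[OF 1] 2 by (meson rtrancl_trans)
  qed
  from sort_labels[OF sg lab(2) dist lab(1) this] obtain j where
    j: "j \<le> card {e \<in> B. l e \<noteq> l' e} * (6 * (2 * m))" "(exchange_step V E ^^ j) (B, l) (B, l')" by blast
  have finB: "finite B" and cB: "card B \<le> ?n"
    using B simple_graph_finite[OF sg] finite_subset unfolding tree_basis_def by auto
  have c: "card (B - B1) \<le> ?n" "card (B - B2) \<le> ?n" "card {e \<in> B. l e \<noteq> l' e} \<le> ?n"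
    using finB cB card_mono[of B "B - B1"] card_mono[of B "B - B2"] card_mono[of B "{e \<in> B. l e \<noteq> l' e}"]
    by auto
  have "j \<le> ?n * (6 * (2 * m))" using j(1) mult_le_mono1[OF c(3)] by (rule le_trans)
  then have "card (B - B1) + j + card (B - B2) \<le> 2 * ?n + 12 * (?n * m)" using c by simp
  then have "real (card (B - B1) + j + card (B - B2)) \<le> real (2 * ?n + 12 * (?n * m))" by (rule of_nat_mono)
  also have "\<dots> = 2 * real ?n + 12 * real ?n * real m" by simp
  also have "\<dots> \<le> 2 * real ?n + 12 * real ?n * (1 + log 2 (real ?n))"
  proof -
    have "log 2 (real (2 * ?n)) = 1 + log 2 (real ?n)" using n by (simp add: log_mult)
    moreover have "0 \<le> log 2 (real (2 * ?n))" using n by simp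
    ultimately have "real m \<le> 1 + log 2 (real ?n)" unfolding m_def by linarith
    then show ?thesis by (intro add_left_mono mult_left_mono) auto
  qed
  also have "\<dots> = 14 * real ?n + 12 * real ?n * log 2 (real ?n)" by (simp add: algebra_simps)
  finally have "real (card (B - B1) + j + card (B - B2)) \<le> 14 * real ?n + 12 * real ?n * log 2 (real ?n)" .
  moreover have "(exchange_step V E ^^ (card (B - B1) + j + card (B - B2))) (B1, l1) (B2, l2)"
    using relpowp_trans[OF relpowp_trans[OF l(1) j(2)] exchange_steps_sym[OF sg lab2 l'(1)]] .
  ultimately show ?thesis by blast
qed

theorem theorem2:
  "\<exists>f :: nat \<Rightarrow> real. f \<in> O(\<lambda>n. real n * ln (real n)) \<and>
     (\<forall>(V :: 'a set) E B\<^sub>1 l\<^sub>1 B\<^sub>2 l\<^sub>2.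
        simple_graph V E \<longrightarrow>
        labelled_spanning_tree V E (B\<^sub>1, l\<^sub>1) \<longrightarrow>
        labelled_spanning_tree V E (B\<^sub>2, l\<^sub>2) \<longrightarrow>
        (\<forall>i\<in>{1..card V - 1}. same_block E (inv_into B\<^sub>1 l\<^sub>1 i) (inv_into B\<^sub>2 l\<^sub>2 i)) \<longrightarrow>
        (\<exists>k. real k \<le> f (card V) \<and> (exchange_step V E ^^ k) (B\<^sub>1, l\<^sub>1) (B\<^sub>2, l\<^sub>2)))"
proof (intro exI[of _ "\<lambda>n. 14 * real n + 12 * real n * log 2 (real n)"] conjI allI impI)
  show "(\<lambda>n. 14 * real n + 12 * real n * log 2 (real n)) \<in> O(\<lambda>n. real n * ln (real n))"
    by real_asymp
next
  fix V :: "'a set" and E B1 l1 B2 l2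
  assume sg: "simple_graph V E" and lab: "labelled_spanning_tree V E (B1, l1)" "labelled_spanning_tree V E (B2, l2)"
    and blocks: "\<forall>i\<in>{1..card V - 1}. same_block E (inv_into B1 l1 i) (inv_into B2 l2 i)"
  show "\<exists>k. real k \<le> 14 * real (card V) + 12 * real (card V) * log 2 (real (card V)) \<and>
      (exchange_step V E ^^ k) (B1, l1) (B2, l2)"
  proof (cases "V = {}")
    \<comment> \<open>The bound is 0 for the empty graph, so the two labelled trees must already
      coincide; the empty label set makes both trees empty.\<close>
    case True
    then have "B1 = {}" "B2 = {}" "l1 \<in> extensional {}" "l2 \<in> extensional {}"
      using lab unfolding labelled_spanning_tree_def by (auto simp: bij_betw_def)
    then have "(B1, l1) = (B2, l2)" by simp
    then show ?thesis using True by (intro exI[of _ 0]) simp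
  next
    case False
    show ?thesis by (rule reconfigure[OF sg False lab]) (use blocks in blast)
  qed
qed

end
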